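(* The assignments $(A,d_m)\mapsto(\mathrm{Tot}(A),d,F)$, where $F$ is the column filtration of $\mathrm{Tot}(A)$, and $f\mapsto \mathrm{Tot}(f)$ define a functor $\mathrm{Tot}:\mathrm{tC}_R\to \mathrm{fC}_R$ from twisted complexes to filtered complexes, which is an isomorphism of categories when restricted to its image, the full subcategory $\mathrm{sfC}_R\subset \mathrm{fC}_R$ of split filtered complexes.
   Context: $R$ is a commutative ring with unit. A bigraded module $A=\{A_i^j\}$ is a $(\mathbb Z,\mathbb Z)$-bigraded $R$-module; a map of bidegree $(p,q)$ sends $A_i^j$ to $A_{i+p}^{j+q}$. The category $\mathrm{tC}_R$: a twisted complex $(A,d_m)$ is a bigraded module $A$ with maps $d_m:A\to A$, $m\ge 0$, of bidegree $(-m,-m+1)$ such that $\sum_{i+j=m}(-1)^i d_id_j=0$ for all $m\geq 0$. A morphism $f:(A,d^A_m)\to(B,d^B_m)$ is a family $f_m:A\to B$, $m\ge0$, of bidegree $(-m,-m)$ with $\sum_{i+j=m}d_i^Bf_j=\sum_{i+j=m}(-1)^if_id_j^A$ for all $m\ge 0$. Composition is $(g\circ f)_m=\sum_{i+j=m}g_if_j$. The category $\mathrm{fC}_R$: filtered complexes $(K,d,F)$, i.e. cochain complexes of $R$-modules (differential of degree $+1$) with an increasing filtration $F_pK^n$ ($p\in\mathbb Z$) of each $K^n$ by submodules, $K^n=\bigcup_pF_pK^n$, $d(F_pK^n)\subset F_pK^{n+1}$; morphisms are morphisms of complexes $f$ with $f(F_pK)\subset F_pL$. Totalization: $\mathrm{Tot}(A)^n:=\prod_{i\le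 0}A_i^{n+i}\oplus\bigoplus_{i>0}A_i^{n+i}$, with column filtration $F_p\mathrm{Tot}(A)^n:=\prod_{i\le p}A_i^{n+i}$ (those elements whose components of index $>p$ vanish). For $a=(a_i)_i\in \mathrm{Tot}(A)^n$, $a_i\in A_i^{n+i}$, put $d(a)_j:=\sum_{m\ge0}(-1)^{mn}d_m(a_{j+m})$ and, for a morphism $f$ of twisted complexes, $(\mathrm{Tot}(f)(a))_j:=\sum_{m\ge0}(-1)^{mn}f_m(a_{j+m})$. A filtered complex $(K,d,F)$ is split if $K=\mathrm{Tot}(A)$ is the total graded module of a bigraded module $A$ (the bigraded module $A$, i.e. the splitting, being part of the object) and $F$ is the column filtration; morphisms in $\mathrm{sfC}_R$ are all morphisms of filtered complexes. *)

theory Defs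
  imports "HOL-Algebra.Module" "HOL-Library.FuncSet"
begin

section \<open>Categories\<close>

text \<open>Hom-sets need not be disjoint, so composition and the action of a functor on morphisms
  take the objects involved as arguments: \<open>Comp C X Y Z g f\<close> is the composite of
  \<open>f : X \<rightarrow> Y\<close> and \<open>g : Y \<rightarrow> Z\<close>.\<close>

record ('o, 'm) cat =
  Ob :: "'o set"
  Mor :: "'o \<Rightarrow> 'o \<Rightarrow> 'm set"
  Ident :: "'o \<Rightarrow> 'm"
  Comp :: "'o \<Rightarrow> 'o \<Rightarrow> 'o \<Rightarrow> 'm \<Rightarrow> 'm \<Rightarrow> 'm"

locale category =
  fixes C :: "('o, 'm) cat"
  assumes ident_mor: "X \<in> Ob C \<Longrightarrow> Ident C X \<in> Mor C X X"
    and comp_mor: "\<lbrakk>X \<in> Ob C; Y \<in> Ob C; Z \<in> Ob C; f \<in> Mor C X Y; g \<in> Mor C Y Z\<rbrakk>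
      \<Longrightarrow> Comp C X Y Z g f \<in> Mor C X Z"
    and comp_ident: "\<lbrakk>X \<in> Ob C; Y \<in> Ob C; f \<in> Mor C X Y\<rbrakk> \<Longrightarrow> Comp C X X Y f (Ident C X) = f"
    and ident_comp: "\<lbrakk>X \<in> Ob C; Y \<in> Ob C; f \<in> Mor C X Y\<rbrakk> \<Longrightarrow> Comp C X Y Y (Ident C Y) f = f"
    and comp_assoc: "\<lbrakk>W \<in> Ob C; X \<in> Ob C; Y \<in> Ob C; Z \<in> Ob C;
        f \<in> Mor C W X; g \<in> Mor C X Y; h \<in> Mor C Y Z\<rbrakk>
      \<Longrightarrow> Comp C W Y Z h (Comp C W X Y g f) = Comp C W X Z (Comp C X Y Z h g) f"

record ('o, 'm, 'p, 'n) cat_functor =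
  fobj :: "'o \<Rightarrow> 'p"
  fmor :: "'o \<Rightarrow> 'o \<Rightarrow> 'm \<Rightarrow> 'n"

locale is_functor = dom: category C + cod: category D
  for C :: "('o, 'm) cat" and D :: "('p, 'n) cat" +
  fixes F :: "('o, 'm, 'p, 'n) cat_functor"
  assumes obj: "X \<in> Ob C \<Longrightarrow> fobj F X \<in> Ob D"
    and mor: "\<lbrakk>X \<in> Ob C; Y \<in> Ob C; f \<in> Mor C X Y\<rbrakk>
      \<Longrightarrow> fmor F X Y f \<in> Mor D (fobj F X) (fobj F Y)"
    and ident: "X \<in> Ob C \<Longrightarrow> fmor F X X (Ident C X) = Ident D (fobj F X)"
    and comp: "\<lbrakk>X \<in> Ob C; Y \<in> Ob C; Z \<in> Ob C; f \<in> Mor C X Y; g \<in> Mor C Y Z\<rbrakk>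
      \<Longrightarrow> fmor F X Z (Comp C X Y Z g f)
        = Comp D (fobj F X) (fobj F Y) (fobj F Z) (fmor F Y Z g) (fmor F X Y f)"

definition id_functor :: "('o, 'm, 'o, 'm) cat_functor" where
  "id_functor = \<lparr>fobj = (\<lambda>X. X), fmor = (\<lambda>X Y f. f)\<rparr>"

definition comp_functor ::
  "('p, 'n, 'q, 'k) cat_functor \<Rightarrow> ('o, 'm, 'p, 'n) cat_functor \<Rightarrow> ('o, 'm, 'q, 'k) cat_functor" where
  "comp_functor G F = \<lparr>fobj = (\<lambda>X. fobj G (fobj F X)),
     fmor = (\<lambda>X Y f. fmor G (fobj F X) (fobj F Y) (fmor F X Y f))\<rparr>"

definition functor_eq ::
  "('o, 'm) cat \<Rightarrow> ('o, 'm, 'p, 'n) cat_functor \<Rightarrow> ('o, 'm, 'p, 'n) cat_functor \<Rightarrow> bool" where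
  "functor_eq C F G \<longleftrightarrow> (\<forall>X\<in>Ob C. fobj F X = fobj G X) \<and>
     (\<forall>X\<in>Ob C. \<forall>Y\<in>Ob C. \<forall>f\<in>Mor C X Y. fmor F X Y f = fmor G X Y f)"

definition isomorphism_of_categories ::
  "('o, 'm) cat \<Rightarrow> ('p, 'n) cat \<Rightarrow> ('o, 'm, 'p, 'n) cat_functor \<Rightarrow> bool" where
  "isomorphism_of_categories C D F \<longleftrightarrow> is_functor C D F \<and>
     (\<exists>G. is_functor D C G \<and> functor_eq C (comp_functor G F) id_functor
        \<and> functor_eq D (comp_functor F G) id_functor)"

text \<open>\<open>F\<close> exhibits \<open>C\<close> as a full subcategory of \<open>D\<close>.\<close>

definition full_subcategory_inclusion ::
  "('o, 'm) cat \<Rightarrow> ('p, 'n) cat \<Rightarrow> ('o, 'm, 'p, 'n) cat_functor \<Rightarrow> bool" where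
  "full_subcategory_inclusion C D F \<longleftrightarrow> is_functor C D F \<and> inj_on (fobj F) (Ob C) \<and>
     (\<forall>X\<in>Ob C. \<forall>Y\<in>Ob C. bij_betw (fmor F X Y) (Mor C X Y) (Mor D (fobj F X) (fobj F Y)))"

section \<open>Modules\<close>

text \<open>For two modules to be equal as soon as they have the same underlying set, zero,
  addition and scalar multiplication, the values of the operations outside
  the carrier, and the fields \<open>mult\<close> and \<open>one\<close> that the module record inherits from rings, are
  fixed to be \<open>undefined\<close>. For the same reason all maps are extensional.\<close>

definition std_module :: "('r, 's) ring_scheme \<Rightarrow> ('r, 'a) module \<Rightarrow> ('r, 'a) module" where
  "std_module R M = \<lparr>carrier = carrier M, mult = undefined, one = undefined, zero = \<zero>\<^bsub>M\<^esub>,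
     add = (\<lambda>x\<in>carrier M. \<lambda>y\<in>carrier M. x \<oplus>\<^bsub>M\<^esub> y),
     smult = (\<lambda>r\<in>carrier R. \<lambda>x\<in>carrier M. r \<odot>\<^bsub>M\<^esub> x)\<rparr>"

definition is_module :: "('r, 's) ring_scheme \<Rightarrow> ('r, 'a) module \<Rightarrow> bool" where
  "is_module R M \<longleftrightarrow> module R M \<and> std_module R M = M"

definition mod_hom ::
  "('r, 's) ring_scheme \<Rightarrow> ('r, 'a) module \<Rightarrow> ('r, 'b) module \<Rightarrow> ('a \<Rightarrow> 'b) set" where
  "mod_hom R M N = {f \<in> carrier M \<rightarrow>\<^sub>E carrier N.
     (\<forall>x\<in>carrier M. \<forall>y\<in>carrier M. f (x \<oplus>\<^bsub>M\<^esub> y) = f x \<oplus>\<^bsub>N\<^esub> f y) \<and>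
     (\<forall>r\<in>carrier R. \<forall>x\<in>carrier M. f (r \<odot>\<^bsub>M\<^esub> x) = r \<odot>\<^bsub>N\<^esub> f x)}"

text \<open>\<open>signed M k x\<close> is $(-1)^k x$.\<close>

definition signed :: "('r, 'a) module \<Rightarrow> int \<Rightarrow> 'a \<Rightarrow> 'a" where
  "signed M k x = (if even k then x else \<ominus>\<^bsub>M\<^esub> x)"

text \<open>The sum over all $m \ge 0$ of a family with finitely many nonzero members.\<close>

definition supp_sum :: "('r, 'a) module \<Rightarrow> (nat \<Rightarrow> 'a) \<Rightarrow> 'a" where
  "supp_sum M g = finsum M g {m. g m \<noteq> \<zero>\<^bsub>M\<^esub>}"

section \<open>Twisted complexes\<close>

text \<open>\<open>A i j\<close> is $A_i^j$.\<close>

type_synonym ('r, 'a) bigraded = "int \<Rightarrow> int \<Rightarrow> ('r, 'a) module"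

definition bigraded_module :: "('r, 's) ring_scheme \<Rightarrow> ('r, 'a) bigraded \<Rightarrow> bool" where
  "bigraded_module R A \<longleftrightarrow> (\<forall>i j. is_module R (A i j))"

definition bigraded_map :: "('r, 's) ring_scheme \<Rightarrow> ('r, 'a) bigraded \<Rightarrow> ('r, 'b) bigraded \<Rightarrow>
    int \<Rightarrow> int \<Rightarrow> (int \<Rightarrow> int \<Rightarrow> 'a \<Rightarrow> 'b) set" where
  "bigraded_map R A B p q = {f. \<forall>i j. f i j \<in> mod_hom R (A i j) (B (i + p) (j + q))}"

text \<open>\<open>tdiff X m i j\<close> is the component of $d_m$ with source $A_i^j$.\<close>

record ('r, 'a) twisted =
  tmod :: "('r, 'a) bigraded"
  tdiff :: "nat \<Rightarrow> int \<Rightarrow> int \<Rightarrow> 'a \<Rightarrow> 'a"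

definition twisted_complex :: "('r, 's) ring_scheme \<Rightarrow> ('r, 'a) twisted \<Rightarrow> bool" where
  "twisted_complex R X \<longleftrightarrow> (let A = tmod X; d = tdiff X in
     bigraded_module R A \<and>
     (\<forall>m. d m \<in> bigraded_map R A A (- int m) (- int m + 1)) \<and>
     (\<forall>m p q. \<forall>x\<in>carrier (A p q).
        (let T = A (p - int m) (q - int m + 2) in
         finsum T (\<lambda>i. signed T (int i)
             (d i (p - int (m - i)) (q - int (m - i) + 1) (d (m - i) p q x))) {..m} = \<zero>\<^bsub>T\<^esub>)))"

definition twisted_mor :: "('r, 's) ring_scheme \<Rightarrow> ('r, 'a) twisted \<Rightarrow> ('r, 'a) twisted \<Rightarrow>
    (nat \<Rightarrow> int \<Rightarrow> int \<Rightarrow> 'a \<Rightarrow> 'a) set" where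
  "twisted_mor R X Y = {f.
     (\<forall>m. f m \<in> bigraded_map R (tmod X) (tmod Y) (- int m) (- int m)) \<and>
     (\<forall>m p q. \<forall>x\<in>carrier (tmod X p q).
        (let T = tmod Y (p - int m) (q - int m + 1) in
         finsum T (\<lambda>i. tdiff Y i (p - int (m - i)) (q - int (m - i)) (f (m - i) p q x)) {..m}
         = finsum T (\<lambda>i. signed T (int i)
             (f i (p - int (m - i)) (q - int (m - i) + 1) (tdiff X (m - i) p q x))) {..m}))}"

definition twisted_id :: "('r, 'a) twisted \<Rightarrow> nat \<Rightarrow> int \<Rightarrow> int \<Rightarrow> 'a \<Rightarrow> 'a" where
  "twisted_id X m p q = (\<lambda>x\<in>carrier (tmod X p q).
     if m = 0 then x else \<zero>\<^bsub>tmod X (p - int m) (q - int m)\<^esub>)"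

definition twisted_comp :: "('r, 'a) twisted \<Rightarrow> ('r, 'a) twisted \<Rightarrow> ('r, 'a) twisted \<Rightarrow>
    (nat \<Rightarrow> int \<Rightarrow> int \<Rightarrow> 'a \<Rightarrow> 'a) \<Rightarrow> (nat \<Rightarrow> int \<Rightarrow> int \<Rightarrow> 'a \<Rightarrow> 'a) \<Rightarrow>
    nat \<Rightarrow> int \<Rightarrow> int \<Rightarrow> 'a \<Rightarrow> 'a" where
  "twisted_comp X Y Z g f m p q = (\<lambda>x\<in>carrier (tmod X p q).
     finsum (tmod Z (p - int m) (q - int m))
       (\<lambda>i. g i (p - int (m - i)) (q - int (m - i)) (f (m - i) p q x)) {..m})"

definition tC :: "('r, 's) ring_scheme \<Rightarrow>
    (('r, 'a) twisted, nat \<Rightarrow> int \<Rightarrow> int \<Rightarrow> 'a \<Rightarrow> 'a) cat" where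
  "tC R = \<lparr>Ob = {X. twisted_complex R X}, Mor = twisted_mor R,
     Ident = twisted_id, Comp = twisted_comp\<rparr>"

section \<open>Filtered complexes\<close>

text \<open>\<open>cfilt K p n\<close> is $F_p K^n$.\<close>

record ('r, 'b) filtered =
  cmod :: "int \<Rightarrow> ('r, 'b) module"
  cdiff :: "int \<Rightarrow> 'b \<Rightarrow> 'b"
  cfilt :: "int \<Rightarrow> int \<Rightarrow> 'b set"

definition filtered_complex :: "('r, 's) ring_scheme \<Rightarrow> ('r, 'b) filtered \<Rightarrow> bool" where
  "filtered_complex R K \<longleftrightarrow>
     (\<forall>n. is_module R (cmod K n)) \<and>
     (\<forall>n. cdiff K n \<in> mod_hom R (cmod K n) (cmod K (n + 1))) \<and>
     (\<forall>n. \<forall>x\<in>carrier (cmod K n). cdiff K (n + 1) (cdiff K n x) = \<zero>\<^bsub>cmod K (n + 2)\<^esub>) \<and>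
     (\<forall>p n. submodule (cfilt K p n) R (cmod K n)) \<and>
     (\<forall>n p p'. p \<le> p' \<longrightarrow> cfilt K p n \<subseteq> cfilt K p' n) \<and>
     (\<forall>n. carrier (cmod K n) = (\<Union>p. cfilt K p n)) \<and>
     (\<forall>p n. cdiff K n ` cfilt K p n \<subseteq> cfilt K p (n + 1))"

definition filtered_mor :: "('r, 's) ring_scheme \<Rightarrow> ('r, 'b) filtered \<Rightarrow> ('r, 'b) filtered \<Rightarrow>
    (int \<Rightarrow> 'b \<Rightarrow> 'b) set" where
  "filtered_mor R K L = {f.
     (\<forall>n. f n \<in> mod_hom R (cmod K n) (cmod L n)) \<and>
     (\<forall>n. \<forall>x\<in>carrier (cmod K n). f (n + 1) (cdiff K n x) = cdiff L n (f n x)) \<and>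
     (\<forall>p n. f n ` cfilt K p n \<subseteq> cfilt L p n)}"

definition filtered_id :: "('r, 'b) filtered \<Rightarrow> int \<Rightarrow> 'b \<Rightarrow> 'b" where
  "filtered_id K n = (\<lambda>x\<in>carrier (cmod K n). x)"

definition filtered_comp :: "('r, 'b) filtered \<Rightarrow> (int \<Rightarrow> 'b \<Rightarrow> 'b) \<Rightarrow> (int \<Rightarrow> 'b \<Rightarrow> 'b) \<Rightarrow>
    int \<Rightarrow> 'b \<Rightarrow> 'b" where
  "filtered_comp K g f n = (\<lambda>x\<in>carrier (cmod K n). g n (f n x))"

definition fC :: "('r, 's) ring_scheme \<Rightarrow> (('r, 'b) filtered, int \<Rightarrow> 'b \<Rightarrow> 'b) cat" where
  "fC R = \<lparr>Ob = {K. filtered_complex R K}, Mor = filtered_mor R,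
     Ident = filtered_id, Comp = (\<lambda>K L M. filtered_comp K)\<rparr>"

section \<open>Totalization\<close>

text \<open>An element of $\mathrm{Tot}(A)^n$ is a function \<open>a\<close> with \<open>a i\<close> in \<open>A i (n + i)\<close>; being in
  the direct sum for positive \<open>i\<close> is the finiteness condition.\<close>

definition tot_carrier :: "('r, 'a) bigraded \<Rightarrow> int \<Rightarrow> (int \<Rightarrow> 'a) set" where
  "tot_carrier A n = {a. (\<forall>i. a i \<in> carrier (A i (n + i))) \<and>
     finite {i. i > 0 \<and> a i \<noteq> \<zero>\<^bsub>A i (n + i)\<^esub>}}"

definition tot_mod ::
  "('r, 's) ring_scheme \<Rightarrow> ('r, 'a) bigraded \<Rightarrow> int \<Rightarrow> ('r, int \<Rightarrow> 'a) module" where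
  "tot_mod R A n = std_module R \<lparr>carrier = tot_carrier A n, mult = undefined, one = undefined,
     zero = (\<lambda>i. \<zero>\<^bsub>A i (n + i)\<^esub>),
     add = (\<lambda>a b i. a i \<oplus>\<^bsub>A i (n + i)\<^esub> b i),
     smult = (\<lambda>r a i. r \<odot>\<^bsub>A i (n + i)\<^esub> a i)\<rparr>"

definition column_filt :: "('r, 'a) bigraded \<Rightarrow> int \<Rightarrow> int \<Rightarrow> (int \<Rightarrow> 'a) set" where
  "column_filt A p n = {a \<in> tot_carrier A n. \<forall>i>p. a i = \<zero>\<^bsub>A i (n + i)\<^esub>}"

text \<open>The sums below are finite, because \<open>a (j + m)\<close> vanishes for all large \<open>m\<close>.\<close>

definition tot_diff :: "('r, 'a) twisted \<Rightarrow> int \<Rightarrow> (int \<Rightarrow> 'a) \<Rightarrow> (int \<Rightarrow> 'a)" where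
  "tot_diff X n = (\<lambda>a\<in>tot_carrier (tmod X) n. \<lambda>j.
     (let T = tmod X j (n + 1 + j) in
      supp_sum T (\<lambda>m. signed T (int m * n)
        (tdiff X m (j + int m) (n + (j + int m)) (a (j + int m))))))"

definition tot_mor :: "('r, 'a) twisted \<Rightarrow> ('r, 'a) twisted \<Rightarrow>
    (nat \<Rightarrow> int \<Rightarrow> int \<Rightarrow> 'a \<Rightarrow> 'a) \<Rightarrow> int \<Rightarrow> (int \<Rightarrow> 'a) \<Rightarrow> (int \<Rightarrow> 'a)" where
  "tot_mor X Y f n = (\<lambda>a\<in>tot_carrier (tmod X) n. \<lambda>j.
     (let T = tmod Y j (n + j) in
      supp_sum T (\<lambda>m. signed T (int m * n)
        (f m (j + int m) (n + (j + int m)) (a (j + int m))))))"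

definition tot_complex ::
  "('r, 's) ring_scheme \<Rightarrow> ('r, 'a) twisted \<Rightarrow> ('r, int \<Rightarrow> 'a) filtered" where
  "tot_complex R X = \<lparr>cmod = tot_mod R (tmod X), cdiff = tot_diff X, cfilt = column_filt (tmod X)\<rparr>"

definition Tot :: "('r, 's) ring_scheme \<Rightarrow>
    (('r, 'a) twisted, nat \<Rightarrow> int \<Rightarrow> int \<Rightarrow> 'a \<Rightarrow> 'a,
     ('r, int \<Rightarrow> 'a) filtered, int \<Rightarrow> (int \<Rightarrow> 'a) \<Rightarrow> (int \<Rightarrow> 'a)) cat_functor" where
  "Tot R = \<lparr>fobj = tot_complex R, fmor = tot_mor\<rparr>"

section \<open>Split filtered complexes\<close>

text \<open>The splitting \<open>A\<close> is part of the object.\<close>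

type_synonym ('r, 'a) split = "('r, 'a) bigraded \<times> ('r, int \<Rightarrow> 'a) filtered"

definition split_filtered :: "('r, 's) ring_scheme \<Rightarrow> ('r, 'a) split \<Rightarrow> bool" where
  "split_filtered R S \<longleftrightarrow> (case S of (A, K) \<Rightarrow>
     bigraded_module R A \<and> filtered_complex R K \<and>
     cmod K = tot_mod R A \<and> cfilt K = column_filt A)"

definition sfC :: "('r, 's) ring_scheme \<Rightarrow>
    (('r, 'a) split, int \<Rightarrow> (int \<Rightarrow> 'a) \<Rightarrow> (int \<Rightarrow> 'a)) cat" where
  "sfC R = \<lparr>Ob = {S. split_filtered R S},
     Mor = (\<lambda>S S'. Mor (fC R) (snd S) (snd S')),
     Ident = (\<lambda>S. Ident (fC R) (snd S)),
     Comp = (\<lambda>S S' S''. Comp (fC R) (snd S) (snd S') (snd S''))\<rparr>"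

definition sfC_inclusion :: "(('r, 'a) split, int \<Rightarrow> (int \<Rightarrow> 'a) \<Rightarrow> (int \<Rightarrow> 'a),
    ('r, int \<Rightarrow> 'a) filtered, int \<Rightarrow> (int \<Rightarrow> 'a) \<Rightarrow> (int \<Rightarrow> 'a)) cat_functor" where
  "sfC_inclusion = \<lparr>fobj = snd, fmor = (\<lambda>S S' f. f)\<rparr>"

text \<open>\<open>Tot\<close> with codomain restricted to split filtered complexes.\<close>

definition Tot_split :: "('r, 's) ring_scheme \<Rightarrow>
    (('r, 'a) twisted, nat \<Rightarrow> int \<Rightarrow> int \<Rightarrow> 'a \<Rightarrow> 'a,
     ('r, 'a) split, int \<Rightarrow> (int \<Rightarrow> 'a) \<Rightarrow> (int \<Rightarrow> 'a)) cat_functor" where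
  "Tot_split R = \<lparr>fobj = (\<lambda>X. (tmod X, fobj (Tot R) X)), fmor = fmor (Tot R)\<rparr>"

end

theory Submission
  imports Defs
begin

text \<open>A filtered map \<open>\<Phi>\<close> from the total module of \<open>A\<close> to that of \<open>B\<close> is determined by its
  matrix entries even though the total modules involve infinite products: the \<open>j\<close>-th
  component of \<open>\<Phi> a\<close> does not change when the components of \<open>a\<close> of index below \<open>j\<close> are
  dropped, because \<open>\<Phi>\<close> preserves the filtration step \<open>j - 1\<close>, and only finitely many components of
  \<open>a\<close> remain. Preservation of the filtration also makes the matrix triangular, so up to the signs
  $(-1)^{mn}$ its entries form a family $(\phi_m)_{m \ge 0}$ as in a twisted complex or a morphism of
  twisted complexes. Composition of filtered maps corresponds to a signed convolution of such
  families. The equation for the $d_m$, the equation for a morphism and the composition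
  law of twisted complexes are all instances of this convolution, hence translate into
  $d^2 = 0$, compatibility with the differentials, and functoriality.\<close>

section \<open>Homomorphisms of modules and signed sums\<close>

text \<open>\<open>signed\<close>, \<open>supp_sum\<close> and \<open>mod_hom\<close> accept only
  the record \<open>module\<close> without extra fields, while the locale \<open>module\<close> also
  allows extensions of it; this locale narrows the type.\<close>

locale plain_module = module R M
  for R :: "('r, 's) ring_scheme" and M :: "('r, 'a) module"

lemma plain_moduleI: "module R M \<Longrightarrow> plain_module R M"
  by (rule plain_module.intro)

lemma (in plain_module) signed_closed: "x \<in> carrier M \<Longrightarrow> signed M k x \<in> carrier M"
  by (simp add: signed_def)

lemma (in plain_module) signed_zero: "signed M k \<zero>\<^bsub>M\<^esub> = \<zero>\<^bsub>M\<^esub>"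
  by (simp add: signed_def)

lemma (in plain_module) signed_signed:
  "x \<in> carrier M \<Longrightarrow> signed M k (signed M l x) = signed M (k + l) x"
  by (simp add: signed_def)

lemma (in plain_module) signed_add:
  "\<lbrakk>x \<in> carrier M; y \<in> carrier M\<rbrakk> \<Longrightarrow> signed M k (x \<oplus>\<^bsub>M\<^esub> y) = signed M k x \<oplus>\<^bsub>M\<^esub> signed M k y"
  by (simp add: signed_def M.minus_add)

lemma (in plain_module) signed_smult:
  "\<lbrakk>r \<in> carrier R; x \<in> carrier M\<rbrakk> \<Longrightarrow> signed M k (r \<odot>\<^bsub>M\<^esub> x) = r \<odot>\<^bsub>M\<^esub> signed M k x"
  by (simp add: signed_def smult_r_minus)

lemma signed_even: "even k \<Longrightarrow> signed M k x = x"
  by (simp add: signed_def)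

text \<open>The index set of \<open>supp_sum\<close> depends on the family. Over a fixed finite set
  containing the supports, sums of different families can be compared and added.\<close>

lemma (in plain_module) supp_sum_eq:
  assumes "finite S" "\<And>m. g m \<in> carrier M" "\<And>m. m \<notin> S \<Longrightarrow> g m = \<zero>\<^bsub>M\<^esub>"
  shows "supp_sum M g = finsum M g S"
  unfolding supp_sum_def
  by (rule M.add.finprod_mono_neutral_cong_left) (use assms in auto)

lemma (in plain_module) supp_sum_closed: "(\<And>m. g m \<in> carrier M) \<Longrightarrow> supp_sum M g \<in> carrier M"
  unfolding supp_sum_def by (rule M.finsum_closed) auto

lemma mod_hom_closed: "\<lbrakk>f \<in> mod_hom R M N; x \<in> carrier M\<rbrakk> \<Longrightarrow> f x \<in> carrier N"
  by (auto simp: mod_hom_def)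

lemma mod_hom_add:
  "\<lbrakk>f \<in> mod_hom R M N; x \<in> carrier M; y \<in> carrier M\<rbrakk> \<Longrightarrow> f (x \<oplus>\<^bsub>M\<^esub> y) = f x \<oplus>\<^bsub>N\<^esub> f y"
  by (auto simp: mod_hom_def)

lemma mod_hom_smult:
  "\<lbrakk>f \<in> mod_hom R M N; r \<in> carrier R; x \<in> carrier M\<rbrakk> \<Longrightarrow> f (r \<odot>\<^bsub>M\<^esub> x) = r \<odot>\<^bsub>N\<^esub> f x"
  by (auto simp: mod_hom_def)

lemma mod_homI:
  assumes "\<And>x. x \<notin> carrier M \<Longrightarrow> f x = undefined"
    and "\<And>x. x \<in> carrier M \<Longrightarrow> f x \<in> carrier N"
    and "\<And>x y. \<lbrakk>x \<in> carrier M; y \<in> carrier M\<rbrakk> \<Longrightarrow> f (x \<oplus>\<^bsub>M\<^esub> y) = f x \<oplus>\<^bsub>N\<^esub> f y"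
    and "\<And>r x. \<lbrakk>r \<in> carrier R; x \<in> carrier M\<rbrakk> \<Longrightarrow> f (r \<odot>\<^bsub>M\<^esub> x) = r \<odot>\<^bsub>N\<^esub> f x"
  shows "f \<in> mod_hom R M N"
  using assms by (auto simp: mod_hom_def)

lemma mod_hom_zero:
  assumes "module R M" "module R N" "f \<in> mod_hom R M N"
  shows "f \<zero>\<^bsub>M\<^esub> = \<zero>\<^bsub>N\<^esub>"
proof -
  interpret M: plain_module R M by (rule plain_moduleI) fact
  interpret N: plain_module R N by (rule plain_moduleI) fact
  have "f (\<zero>\<^bsub>R\<^esub> \<odot>\<^bsub>M\<^esub> \<zero>\<^bsub>M\<^esub>) = \<zero>\<^bsub>R\<^esub> \<odot>\<^bsub>N\<^esub> f \<zero>\<^bsub>M\<^esub>"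
    by (rule mod_hom_smult[OF assms(3)]) auto
  then show ?thesis
    using mod_hom_closed[OF assms(3)] by simp
qed

lemma mod_hom_signed:
  assumes "module R M" "module R N" "f \<in> mod_hom R M N" "x \<in> carrier M"
  shows "f (signed M k x) = signed N k (f x)"
proof -
  interpret M: plain_module R M by (rule plain_moduleI) fact
  interpret N: plain_module R N by (rule plain_moduleI) fact
  have "f (\<ominus>\<^bsub>M\<^esub> x) \<oplus>\<^bsub>N\<^esub> f x = f (\<ominus>\<^bsub>M\<^esub> x \<oplus>\<^bsub>M\<^esub> x)"
    using assms by (subst mod_hom_add) auto
  also have "\<dots> = \<zero>\<^bsub>N\<^esub>"
    using assms by (simp add: M.M.l_neg mod_hom_zero)
  finally have "f (\<ominus>\<^bsub>M\<^esub> x) = \<ominus>\<^bsub>N\<^esub> f x"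
    using assms by (metis N.M.minus_equality mod_hom_closed M.M.a_inv_closed)
  then show ?thesis
    by (simp add: signed_def)
qed

lemma mod_hom_finsum:
  assumes "module R M" "module R N" "f \<in> mod_hom R M N" "finite S" "g \<in> S \<rightarrow> carrier M"
  shows "f (finsum M g S) = finsum N (\<lambda>i. f (g i)) S"
proof -
  interpret M: plain_module R M by (rule plain_moduleI) fact
  interpret N: plain_module R N by (rule plain_moduleI) fact
  show ?thesis
    using assms(4,5)
  proof (induction S)
    case empty
    then show ?case using assms by (simp add: mod_hom_zero)
  next
    case (insert x S)
    then have "(\<lambda>i. f (g i)) \<in> S \<rightarrow> carrier N" "f (g x) \<in> carrier N"
      using mod_hom_closed[OF assms(3)] by auto
    with insert show ?case
      by (simp add: mod_hom_add[OF assms(3)])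
  qed
qed

text \<open>Viewing the sign as an endomorphism of \<open>M\<close> makes
  \<open>signed_finsum\<close> a special case of \<open>mod_hom_finsum\<close>.\<close>

lemma (in plain_module) signed_mod_hom: "(\<lambda>x\<in>carrier M. signed M k x) \<in> mod_hom R M M"
  by (rule mod_homI) (auto simp: signed_closed signed_add signed_smult)

lemma (in plain_module) signed_finsum:
  assumes "finite S" "g \<in> S \<rightarrow> carrier M"
  shows "signed M k (finsum M g S) = finsum M (\<lambda>i. signed M k (g i)) S"
proof -
  have "(\<lambda>x\<in>carrier M. signed M k x) (finsum M g S) = finsum M (\<lambda>i. (\<lambda>x\<in>carrier M. signed M k x) (g i)) S"
    by (rule mod_hom_finsum[OF module_axioms module_axioms signed_mod_hom assms])
  also have "\<dots> = finsum M (\<lambda>i. signed M k (g i)) S"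
    using assms by (intro M.add.finprod_cong') (auto simp: signed_closed Pi_def)
  finally show ?thesis using assms by (simp add: M.finsum_closed)
qed

lemma (in plain_module) finsum_mod_hom:
  assumes "finite S" "module R L" "\<And>i. i \<in> S \<Longrightarrow> f i \<in> mod_hom R L M"
  shows "(\<lambda>x\<in>carrier L. finsum M (\<lambda>i. f i x) S) \<in> mod_hom R L M"
proof -
  interpret L: plain_module R L by (rule plain_moduleI) fact
  have closed: "f i x \<in> carrier M" if "i \<in> S" "x \<in> carrier L" for i x
    using mod_hom_closed[OF assms(3)] that by blast
  show ?thesis
  proof (rule mod_homI, goal_cases)
    case (3 x y)
    have "finsum M (\<lambda>i. f i (x \<oplus>\<^bsub>L\<^esub> y)) S = finsum M (\<lambda>i. f i x \<oplus>\<^bsub>M\<^esub> f i y) S"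
      using 3 closed by (intro M.add.finprod_cong') (auto simp: mod_hom_add[OF assms(3)])
    then show ?case using 3 closed by (simp add: M.finsum_addf Pi_def)
  next
    case (4 r x)
    have "finsum M (\<lambda>i. f i (r \<odot>\<^bsub>L\<^esub> x)) S = finsum M (\<lambda>i. r \<odot>\<^bsub>M\<^esub> f i x) S"
      using 4 closed by (intro M.add.finprod_cong') (auto simp: mod_hom_smult[OF assms(3)])
    then show ?case using 4 closed assms(1) by (simp add: finsum_smult_ldistr Pi_def)
  qed (use closed in \<open>auto intro!: M.finsum_closed\<close>)
qed

text \<open>Both sides run over the pairs of naturals with \<open>i + l < N\<close>, once by
  antidiagonals and once by rows. Passing from \<open>N\<close> to \<open>Suc N\<close> adds the
  antidiagonal \<open>i + l = N\<close>.\<close>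

lemma (in abelian_monoid) finsum_triangle:
  assumes "\<And>i l. f i l \<in> carrier G"
  shows "finsum G (\<lambda>k. finsum G (\<lambda>i. f i (k - i)) {..k}) {..<N::nat}
    = finsum G (\<lambda>i. finsum G (f i) {..<N - i}) {..<N}"
proof (induction N)
  case 0
  then show ?case by simp
next
  case (Suc N)
  have [simp]: "finsum G (f i) S \<in> carrier G" "finsum G (\<lambda>i. f i (h i)) S \<in> carrier G" for i h S
    using assms by (auto intro!: finsum_closed)
  \<comment> \<open>The row \<open>i\<close> grows by the single entry \<open>f i (N - i)\<close>;
    for \<open>i = N\<close> the old row is empty and is dropped afterwards.\<close>
  have "finsum G (\<lambda>i. finsum G (f i) {..<Suc N - i}) {..<Suc N}
      = finsum G (\<lambda>i. finsum G (f i) {..<N - i} \<oplus> f i (N - i)) {..<Suc N}"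
    using assms by (intro add.finprod_cong') (auto simp: Suc_diff_le lessThan_Suc a_comm)
  also have "\<dots> = finsum G (\<lambda>i. finsum G (f i) {..<N - i}) {..<Suc N}
      \<oplus> finsum G (\<lambda>i. f i (N - i)) {..<Suc N}"
    using assms by (simp add: finsum_addf Pi_def)
  also have "finsum G (\<lambda>i. finsum G (f i) {..<N - i}) {..<Suc N}
      = finsum G (\<lambda>i. finsum G (f i) {..<N - i}) {..<N}"
    by (simp add: lessThan_Suc)
  also have "finsum G (\<lambda>k. finsum G (\<lambda>i. f i (k - i)) {..k}) {..<Suc N}
      = finsum G (\<lambda>k. finsum G (\<lambda>i. f i (k - i)) {..k}) {..<N} \<oplus> finsum G (\<lambda>i. f i (N - i)) {..N}"
    by (simp add: lessThan_Suc a_comm)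
  ultimately show ?case
    using Suc.IH by (simp add: lessThan_Suc_atMost)
qed

section \<open>Graded and filtered maps between totalizations\<close>

text \<open>Differentials are the case \<open>s = 1\<close> and morphisms the case \<open>s = 0\<close> of the following notions.\<close>

definition gmap :: "('r, 's) ring_scheme \<Rightarrow> ('r, 'a) bigraded \<Rightarrow> ('r, 'b) bigraded \<Rightarrow> int \<Rightarrow>
    (nat \<Rightarrow> int \<Rightarrow> int \<Rightarrow> 'a \<Rightarrow> 'b) set" where
  "gmap R A B s = {\<phi>. \<forall>m. \<phi> m \<in> bigraded_map R A B (- int m) (- int m + s)}"

definition fmap :: "('r, 's) ring_scheme \<Rightarrow> ('r, 'a) bigraded \<Rightarrow> ('r, 'b) bigraded \<Rightarrow> int \<Rightarrow>
    (int \<Rightarrow> (int \<Rightarrow> 'a) \<Rightarrow> (int \<Rightarrow> 'b)) set" where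
  "fmap R A B s = {\<Phi>. (\<forall>n. \<Phi> n \<in> mod_hom R (tot_mod R A n) (tot_mod R B (n + s))) \<and>
     (\<forall>p n. \<Phi> n ` column_filt A p n \<subseteq> column_filt B p (n + s))}"

definition tot_map :: "('r, 'a) bigraded \<Rightarrow> ('r, 'b) bigraded \<Rightarrow> int \<Rightarrow>
    (nat \<Rightarrow> int \<Rightarrow> int \<Rightarrow> 'a \<Rightarrow> 'b) \<Rightarrow> int \<Rightarrow> (int \<Rightarrow> 'a) \<Rightarrow> (int \<Rightarrow> 'b)" where
  "tot_map A B s \<phi> n = (\<lambda>a\<in>tot_carrier A n. \<lambda>j.
     let T = B j (n + s + j) in
      supp_sum T (\<lambda>m. signed T (int m * n) (\<phi> m (j + int m) (n + (j + int m)) (a (j + int m)))))"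

text \<open>The value of $d^2$, the two sides of the equation for a morphism, and the composition law
  are \<open>gcomp\<close> for \<open>(s, t)\<close> equal to $(1, 1)$, $(0, 1)$, $(1, 0)$ and $(0, 0)$. The sign
  arises because $\psi_i$ enters the total map with the sign $(-1)^{in}$, and \<open>\<phi>\<close> changes the
  degree \<open>n\<close> to \<open>n + s\<close>.\<close>

definition gcomp :: "('r, 'a) bigraded \<Rightarrow> ('r, 'c) bigraded \<Rightarrow> int \<Rightarrow> int \<Rightarrow>
    (nat \<Rightarrow> int \<Rightarrow> int \<Rightarrow> 'b \<Rightarrow> 'c) \<Rightarrow> (nat \<Rightarrow> int \<Rightarrow> int \<Rightarrow> 'a \<Rightarrow> 'b) \<Rightarrow>
    nat \<Rightarrow> int \<Rightarrow> int \<Rightarrow> 'a \<Rightarrow> 'c" where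
  "gcomp A C s t \<psi> \<phi> m p q = (\<lambda>x\<in>carrier (A p q).
     let T = C (p - int m) (q - int m + (s + t)) in
     finsum T (\<lambda>i. signed T (s * int i)
       (\<psi> i (p - int (m - i)) (q - int (m - i) + s) (\<phi> (m - i) p q x))) {..m})"

definition tot_incl :: "('r, 'a) bigraded \<Rightarrow> int \<Rightarrow> int \<Rightarrow> 'a \<Rightarrow> int \<Rightarrow> 'a" where
  "tot_incl A n i x = (\<lambda>k. if k = i then x else \<zero>\<^bsub>A k (n + k)\<^esub>)"

text \<open>The matrix entry of \<Phi> from column \<open>p\<close> to column
  \<open>p - int m\<close> in total degree n = \<open>q - p\<close>: include, apply \<Phi>, project.
  The outer sign undoes the sign (-1)^(mn) that \<open>tot_map\<close> puts on its m-th
  summand.\<close>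

definition components :: "('r, 'a) bigraded \<Rightarrow> ('r, 'b) bigraded \<Rightarrow> int \<Rightarrow>
    (int \<Rightarrow> (int \<Rightarrow> 'a) \<Rightarrow> (int \<Rightarrow> 'b)) \<Rightarrow> nat \<Rightarrow> int \<Rightarrow> int \<Rightarrow> 'a \<Rightarrow> 'b" where
  "components A B s \<Phi> m p q = (\<lambda>x\<in>carrier (A p q).
     signed (B (p - int m) (q - int m + s)) (int m * (q - p))
       (\<Phi> (q - p) (tot_incl A (q - p) p x) (p - int m)))"

section \<open>Total modules and their column filtration\<close>

lemma bigraded_module_module: "bigraded_module R A \<Longrightarrow> module R (A i j)"
  by (simp add: bigraded_module_def is_module_def)

text \<open>A set of positive integers is finite exactly if it is bounded above, so the direct sum
  condition says that the element lies in some step of the column filtration.\<close>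

lemma tot_carrier_iff:
  "a \<in> tot_carrier A n \<longleftrightarrow>
    (\<forall>i. a i \<in> carrier (A i (n + i))) \<and> (\<exists>p. \<forall>i>p. a i = \<zero>\<^bsub>A i (n + i)\<^esub>)"
proof -
  have "finite {i. i > 0 \<and> a i \<noteq> \<zero>\<^bsub>A i (n + i)\<^esub>} \<longleftrightarrow> (\<exists>p. \<forall>i>p. a i = \<zero>\<^bsub>A i (n + i)\<^esub>)" (is "finite ?S \<longleftrightarrow> ?B")
  proof
    assume "finite ?S"
    then obtain p where "\<And>i. i \<in> ?S \<Longrightarrow> i \<le> p"
      by (meson bdd_above_def bdd_above_finite)
    \<comment> \<open>The bound \<open>p\<close> controls positive indices only, hence the maximum
      with 0.\<close>
    then have "\<forall>i>max p 0. a i = \<zero>\<^bsub>A i (n + i)\<^esub>"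
      by fastforce
    then show ?B ..
  next
    assume ?B
    then obtain p where "\<forall>i>p. a i = \<zero>\<^bsub>A i (n + i)\<^esub>" ..
    then have "?S \<subseteq> {0..p}" by force
    then show "finite ?S" by (rule finite_subset) simp
  qed
  then show ?thesis by (simp add: tot_carrier_def)
qed

lemma column_filt_iff:
  "a \<in> column_filt A p n \<longleftrightarrow>
    (\<forall>i. a i \<in> carrier (A i (n + i))) \<and> (\<forall>i>p. a i = \<zero>\<^bsub>A i (n + i)\<^esub>)"
  by (auto simp: column_filt_def tot_carrier_iff)

lemma tot_carrier_eq_Union: "tot_carrier A n = (\<Union>p. column_filt A p n)"
  unfolding set_eq_iff UN_iff column_filt_iff tot_carrier_iff by blast

lemma column_filt_subset: "column_filt A p n \<subseteq> tot_carrier A n"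
  by (auto simp: column_filt_def)

lemma column_filt_mono: "p \<le> p' \<Longrightarrow> column_filt A p n \<subseteq> column_filt A p' n"
  by (auto simp: column_filt_iff)

lemma tot_mod_simps:
  "carrier (tot_mod R A n) = tot_carrier A n"
  "\<zero>\<^bsub>tot_mod R A n\<^esub> = (\<lambda>i. \<zero>\<^bsub>A i (n + i)\<^esub>)"
  "\<lbrakk>a \<in> tot_carrier A n; b \<in> tot_carrier A n\<rbrakk>
    \<Longrightarrow> a \<oplus>\<^bsub>tot_mod R A n\<^esub> b = (\<lambda>i. a i \<oplus>\<^bsub>A i (n + i)\<^esub> b i)"
  "\<lbrakk>r \<in> carrier R; a \<in> tot_carrier A n\<rbrakk>
    \<Longrightarrow> r \<odot>\<^bsub>tot_mod R A n\<^esub> a = (\<lambda>i. r \<odot>\<^bsub>A i (n + i)\<^esub> a i)"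
  by (simp_all add: tot_mod_def std_module_def)

locale bigraded =
  fixes R :: "('r, 's) ring_scheme" and A :: "('r, 'a) bigraded"
  assumes bigraded_module: "bigraded_module R A"
begin

sublocale E: plain_module R "A i j" for i j
  using bigraded_module by (intro plain_moduleI bigraded_module_module)

lemma tot_zero_closed: "(\<lambda>i. \<zero>\<^bsub>A i (n + i)\<^esub>) \<in> column_filt A p n"
  by (simp add: column_filt_iff)

lemma column_filt_add:
  "\<lbrakk>a \<in> column_filt A p n; b \<in> column_filt A p n\<rbrakk>
    \<Longrightarrow> (\<lambda>i. a i \<oplus>\<^bsub>A i (n + i)\<^esub> b i) \<in> column_filt A p n"
  by (simp add: column_filt_iff)

lemma column_filt_smult:
  "\<lbrakk>r \<in> carrier R; a \<in> column_filt A p n\<rbrakk> \<Longrightarrow> (\<lambda>i. r \<odot>\<^bsub>A i (n + i)\<^esub> a i) \<in> column_filt A p n"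
  by (simp add: column_filt_iff)

lemma column_filt_minus:
  "a \<in> column_filt A p n \<Longrightarrow> (\<lambda>i. \<ominus>\<^bsub>A i (n + i)\<^esub> a i) \<in> column_filt A p n"
  by (simp add: column_filt_iff)

lemma tot_add_closed:
  assumes "a \<in> tot_carrier A n" "b \<in> tot_carrier A n"
  shows "(\<lambda>i. a i \<oplus>\<^bsub>A i (n + i)\<^esub> b i) \<in> tot_carrier A n"
proof -
  obtain p p' where "a \<in> column_filt A p n" "b \<in> column_filt A p' n"
    using assms unfolding tot_carrier_eq_Union by blast
  then have "a \<in> column_filt A (max p p') n" "b \<in> column_filt A (max p p') n"
    using column_filt_mono by (meson max.cobounded1 max.cobounded2 subsetD)+
  from column_filt_add[OF this] show ?thesis
    using column_filt_subset by blast
qed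

lemma tot_smult_closed:
  "\<lbrakk>r \<in> carrier R; a \<in> tot_carrier A n\<rbrakk> \<Longrightarrow> (\<lambda>i. r \<odot>\<^bsub>A i (n + i)\<^esub> a i) \<in> tot_carrier A n"
  unfolding tot_carrier_eq_Union using column_filt_smult by blast

lemma tot_minus_closed:
  "a \<in> tot_carrier A n \<Longrightarrow> (\<lambda>i. \<ominus>\<^bsub>A i (n + i)\<^esub> a i) \<in> tot_carrier A n"
  unfolding tot_carrier_eq_Union using column_filt_minus by blast

lemma tot_component_closed: "a \<in> tot_carrier A n \<Longrightarrow> a i \<in> carrier (A i (n + i))"
  by (simp add: tot_carrier_def)

lemma tot_zero_in_carrier: "(\<lambda>i. \<zero>\<^bsub>A i (n + i)\<^esub>) \<in> tot_carrier A n"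
  using tot_zero_closed column_filt_subset by blast

lemma tot_module: "module R (tot_mod R A n)"
proof (rule moduleI)
  show "cring R" by (rule E.R.is_cring)
  show "abelian_group (tot_mod R A n)"
  proof (rule abelian_groupI, goal_cases)
    case (6 a)
    then have "(\<lambda>i. \<ominus>\<^bsub>A i (n + i)\<^esub> a i) \<in> tot_carrier A n"
      by (simp add: tot_mod_simps tot_minus_closed)
    moreover have "(\<lambda>i. \<ominus>\<^bsub>A i (n + i)\<^esub> a i) \<oplus>\<^bsub>tot_mod R A n\<^esub> a = \<zero>\<^bsub>tot_mod R A n\<^esub>"
      using 6 by (simp add: tot_mod_simps tot_minus_closed tot_component_closed E.M.l_neg)
    ultimately show ?case by (auto simp: tot_mod_simps)
  qed (simp_all add: tot_mod_simps tot_add_closed tot_zero_in_carrier tot_component_closed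
      E.M.add.m_ac)
qed (simp_all add: tot_mod_simps tot_add_closed tot_smult_closed tot_component_closed
      E.smult_l_distr E.smult_r_distr E.smult_assoc1)

text \<open>\<open>tot_mod\<close> is itself a value of \<open>std_module\<close>, and normalizing
  twice changes nothing.\<close>

lemma tot_is_module: "is_module R (tot_mod R A n)"
proof -
  have "std_module R (tot_mod R A n) = tot_mod R A n"
    by (auto simp: tot_mod_def std_module_def fun_eq_iff restrict_def)
  then show ?thesis by (simp add: is_module_def tot_module)
qed

lemma tot_minus:
  assumes "a \<in> tot_carrier A n"
  shows "\<ominus>\<^bsub>tot_mod R A n\<^esub> a = (\<lambda>i. \<ominus>\<^bsub>A i (n + i)\<^esub> a i)"
proof -
  interpret T: plain_module R "tot_mod R A n" by (rule plain_moduleI[OF tot_module])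
  show ?thesis
    using assms
    by (intro T.M.minus_equality)
      (simp_all add: tot_mod_simps tot_minus_closed tot_component_closed E.M.l_neg)
qed

lemma column_filt_submodule: "submodule (column_filt A p n) R (tot_mod R A n)"
proof -
  interpret T: plain_module R "tot_mod R A n" by (rule plain_moduleI[OF tot_module])
  note sub = subsetD[OF column_filt_subset]
  show ?thesis
  proof (rule T.submoduleI, goal_cases)
    case (3 a)
    then show ?case by (simp add: sub tot_minus column_filt_minus)
  qed (auto simp: sub tot_mod_simps tot_zero_closed column_filt_add column_filt_smult)
qed

lemma tot_incl_filt: "x \<in> carrier (A i (n + i)) \<Longrightarrow> tot_incl A n i x \<in> column_filt A i n"
  by (simp add: column_filt_iff tot_incl_def)

lemma tot_incl_closed: "x \<in> carrier (A i (n + i)) \<Longrightarrow> tot_incl A n i x \<in> tot_carrier A n"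
  using tot_incl_filt column_filt_subset by blast

lemma tot_incl_hom: "(\<lambda>x\<in>carrier (A i (n + i)). tot_incl A n i x) \<in> mod_hom R (A i (n + i)) (tot_mod R A n)"
  by (rule mod_homI) (simp_all add: tot_mod_simps tot_incl_closed, auto simp: tot_incl_def)

end

section \<open>Total maps of graded families and matrix entries of filtered maps\<close>

locale bigraded_pair = A: bigraded R A + B: bigraded R B
  for R :: "('r, 's) ring_scheme" and A :: "('r, 'a) bigraded" and B :: "('r, 'b) bigraded" +
  fixes s :: int
begin

text \<open>Equations between source and target indices let the rule serve for a target column
  \<open>j\<close> with source \<open>j + int m\<close> as well as for a source column
  \<open>p\<close> with target \<open>p - int m\<close>.\<close>

lemma gmap_hom:
  assumes "\<phi> \<in> gmap R A B s" "p = p' + int m" "q = q' + int m - s"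
  shows "\<phi> m p q \<in> mod_hom R (A p q) (B p' q')"
proof -
  have "\<phi> m p q \<in> mod_hom R (A p q) (B (p + - int m) (q + (- int m + s)))"
    using assms(1) by (simp add: gmap_def bigraded_map_def)
  moreover have "p + - int m = p'" "q + (- int m + s) = q'"
    using assms by auto
  ultimately show ?thesis by simp
qed

text \<open>Naming the m-th summand of \<open>tot_map\<close> lets closure, vanishing and linearity
  be proved before any summation.\<close>

definition tot_term :: "(nat \<Rightarrow> int \<Rightarrow> int \<Rightarrow> 'a \<Rightarrow> 'b) \<Rightarrow> int \<Rightarrow> int \<Rightarrow> (int \<Rightarrow> 'a) \<Rightarrow> nat \<Rightarrow> 'b" where
  "tot_term \<phi> n j a m = signed (B j (n + s + j)) (int m * n)
     (\<phi> m (j + int m) (n + (j + int m)) (a (j + int m)))"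

lemma tot_map_supp_sum:
  "a \<in> tot_carrier A n
    \<Longrightarrow> tot_map A B s \<phi> n a j = supp_sum (B j (n + s + j)) (tot_term \<phi> n j a)"
  by (simp add: tot_map_def tot_term_def[abs_def] Let_def)

lemma gmap_hom_tot:
  "\<phi> \<in> gmap R A B s
    \<Longrightarrow> \<phi> m (j + int m) (n + (j + int m)) \<in> mod_hom R (A (j + int m) (n + (j + int m))) (B j (n + s + j))"
  by (erule gmap_hom) auto

lemma gmap_tot_closed:
  "\<lbrakk>\<phi> \<in> gmap R A B s; a \<in> tot_carrier A n\<rbrakk>
    \<Longrightarrow> \<phi> m (j + int m) (n + (j + int m)) (a (j + int m)) \<in> carrier (B j (n + s + j))"
  by (meson gmap_hom_tot mod_hom_closed A.tot_component_closed)

lemma tot_term_closed: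
  "\<lbrakk>\<phi> \<in> gmap R A B s; a \<in> tot_carrier A n\<rbrakk>
    \<Longrightarrow> tot_term \<phi> n j a m \<in> carrier (B j (n + s + j))"
  unfolding tot_term_def by (intro B.E.signed_closed gmap_tot_closed)

lemma tot_term_zero:
  "\<lbrakk>\<phi> \<in> gmap R A B s; a (j + int m) = \<zero>\<^bsub>A (j + int m) (n + (j + int m))\<^esub>\<rbrakk>
    \<Longrightarrow> tot_term \<phi> n j a m = \<zero>\<^bsub>B j (n + s + j)\<^esub>"
  unfolding tot_term_def
  by (simp add: mod_hom_zero[OF A.E.module_axioms B.E.module_axioms gmap_hom_tot] B.E.signed_zero)

lemma tot_term_add:
  assumes "\<phi> \<in> gmap R A B s" "a \<in> tot_carrier A n" "b \<in> tot_carrier A n"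
  shows "tot_term \<phi> n j (\<lambda>i. a i \<oplus>\<^bsub>A i (n + i)\<^esub> b i)
    = (\<lambda>m. tot_term \<phi> n j a m \<oplus>\<^bsub>B j (n + s + j)\<^esub> tot_term \<phi> n j b m)"
  unfolding tot_term_def fun_eq_iff
  using assms
  by (simp add: mod_hom_add[OF gmap_hom_tot] A.tot_component_closed B.E.signed_add gmap_tot_closed)

lemma tot_term_smult:
  assumes "\<phi> \<in> gmap R A B s" "a \<in> tot_carrier A n" "r \<in> carrier R"
  shows "tot_term \<phi> n j (\<lambda>i. r \<odot>\<^bsub>A i (n + i)\<^esub> a i)
    = (\<lambda>m. r \<odot>\<^bsub>B j (n + s + j)\<^esub> tot_term \<phi> n j a m)"
  unfolding tot_term_def fun_eq_iff
  using assms
  by (simp add: mod_hom_smult[OF gmap_hom_tot] A.tot_component_closed B.E.signed_smult gmap_tot_closed)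

text \<open>If \<open>m \<ge> N\<close>, then \<open>j + int m\<close> exceeds \<open>p\<close> and
  the summand vanishes. The range depends only on \<open>p\<close> and \<open>j\<close>, so one
  range serves for all elements of the filtration step.\<close>

lemma tot_map_eq_finsum:
  assumes "\<phi> \<in> gmap R A B s" "a \<in> column_filt A p n" "p < j + int N"
  shows "tot_map A B s \<phi> n a j = finsum (B j (n + s + j)) (tot_term \<phi> n j a) {..<N}"
proof -
  have a: "a \<in> tot_carrier A n"
    using assms(2) column_filt_subset by blast
  have "supp_sum (B j (n + s + j)) (tot_term \<phi> n j a)
      = finsum (B j (n + s + j)) (tot_term \<phi> n j a) {..<N}"
    by (rule B.E.supp_sum_eq)
      (use assms a in \<open>auto intro!: tot_term_zero simp: tot_term_closed column_filt_iff\<close>)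
  then show ?thesis by (simp add: tot_map_supp_sum a)
qed

lemma tot_map_filt:
  assumes "\<phi> \<in> gmap R A B s" "a \<in> column_filt A p n"
  shows "tot_map A B s \<phi> n a \<in> column_filt B p (n + s)"
  unfolding column_filt_iff
proof (intro conjI allI impI)
  have a: "a \<in> tot_carrier A n"
    using assms(2) column_filt_subset by blast
  fix j
  show "tot_map A B s \<phi> n a j \<in> carrier (B j (n + s + j))"
    by (simp add: tot_map_supp_sum a) (intro B.E.supp_sum_closed tot_term_closed assms a)
  \<comment> \<open>With \<open>N = 0\<close> the sum is empty: every summand reads a component of
    \<open>a\<close> of index at least \<open>j\<close>, hence above \<open>p\<close>.\<close>
  show "tot_map A B s \<phi> n a j = \<zero>\<^bsub>B j (n + s + j)\<^esub>" if "p < j"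
    using tot_map_eq_finsum[OF assms, of j 0] that by simp
qed

lemma tot_map_fmap:
  assumes "\<phi> \<in> gmap R A B s"
  shows "tot_map A B s \<phi> \<in> fmap R A B s"
proof -
  have closed: "tot_map A B s \<phi> n a \<in> tot_carrier B (n + s)" if "a \<in> tot_carrier A n" for n a
    using tot_map_filt[OF assms] that unfolding tot_carrier_eq_Union by blast
  have "tot_map A B s \<phi> n \<in> mod_hom R (tot_mod R A n) (tot_mod R B (n + s))" for n
  proof (rule mod_homI, unfold tot_mod_simps(1))
    show "tot_map A B s \<phi> n a = undefined" if "a \<notin> tot_carrier A n" for a
      using that by (simp add: tot_map_def)
    show "tot_map A B s \<phi> n a \<in> tot_carrier B (n + s)" if "a \<in> tot_carrier A n" for a
      using that by (rule closed)
  next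
    fix a b assume ab: "a \<in> tot_carrier A n" "b \<in> tot_carrier A n"
    then obtain p p' where "a \<in> column_filt A p n" "b \<in> column_filt A p' n"
      unfolding tot_carrier_eq_Union by blast
    \<comment> \<open>A common filtration step gives one summation range for \<open>a\<close>,
      \<open>b\<close> and their sum.\<close>
    then obtain p where filt: "a \<in> column_filt A p n" "b \<in> column_filt A p n"
      using column_filt_mono[of _ "max p p'"] by (meson max.cobounded1 max.cobounded2 subsetD)
    have "tot_map A B s \<phi> n (\<lambda>i. a i \<oplus>\<^bsub>A i (n + i)\<^esub> b i) j
        = tot_map A B s \<phi> n a j \<oplus>\<^bsub>B j (n + s + j)\<^esub> tot_map A B s \<phi> n b j" for j
    proof -
      \<comment> \<open>If \<open>p < j\<close>, then \<open>nat\<close> cuts the witness down to 0,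
        and 0 suffices.\<close>
      obtain N where N: "p < j + int N"
        by (rule that[of "nat (p - j + 1)"]) simp
      show ?thesis
        using tot_term_closed[OF assms] ab
        by (simp add: tot_map_eq_finsum[OF assms _ N] filt A.column_filt_add tot_term_add assms
            B.E.M.finsum_addf Pi_def)
    qed
    then show "tot_map A B s \<phi> n (a \<oplus>\<^bsub>tot_mod R A n\<^esub> b)
        = tot_map A B s \<phi> n a \<oplus>\<^bsub>tot_mod R B (n + s)\<^esub> tot_map A B s \<phi> n b"
      by (simp add: tot_mod_simps ab closed fun_eq_iff)
  next
    fix r a assume r: "r \<in> carrier R" and a: "a \<in> tot_carrier A n"
    then obtain p where filt: "a \<in> column_filt A p n"
      unfolding tot_carrier_eq_Union by blast
    have "tot_map A B s \<phi> n (\<lambda>i. r \<odot>\<^bsub>A i (n + i)\<^esub> a i) j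
        = r \<odot>\<^bsub>B j (n + s + j)\<^esub> tot_map A B s \<phi> n a j" for j
    proof -
      obtain N where N: "p < j + int N"
        by (rule that[of "nat (p - j + 1)"]) simp
      show ?thesis
        using tot_term_closed[OF assms] a r
        by (simp add: tot_map_eq_finsum[OF assms _ N] filt A.column_filt_smult tot_term_smult assms
            B.E.finsum_smult_ldistr Pi_def)
    qed
    then show "tot_map A B s \<phi> n (r \<odot>\<^bsub>tot_mod R A n\<^esub> a)
        = r \<odot>\<^bsub>tot_mod R B (n + s)\<^esub> tot_map A B s \<phi> n a"
      by (simp add: tot_mod_simps a r closed fun_eq_iff)
  qed
  then show ?thesis
    using tot_map_filt[OF assms] by (auto simp: fmap_def)
qed

lemma fmap_hom: "\<Phi> \<in> fmap R A B s \<Longrightarrow> \<Phi> n \<in> mod_hom R (tot_mod R A n) (tot_mod R B (n + s))"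
  by (simp add: fmap_def)

lemma fmap_filt: "\<lbrakk>\<Phi> \<in> fmap R A B s; a \<in> column_filt A p n\<rbrakk> \<Longrightarrow> \<Phi> n a \<in> column_filt B p (n + s)"
  by (simp add: fmap_def image_subset_iff)

lemma fmap_closed: "\<lbrakk>\<Phi> \<in> fmap R A B s; a \<in> tot_carrier A n\<rbrakk> \<Longrightarrow> \<Phi> n a \<in> tot_carrier B (n + s)"
  using mod_hom_closed[OF fmap_hom] by (simp add: tot_mod_simps)

lemma fmap_component_closed:
  "\<lbrakk>\<Phi> \<in> fmap R A B s; a \<in> tot_carrier A n\<rbrakk> \<Longrightarrow> \<Phi> n a j \<in> carrier (B j (n + s + j))"
  by (simp add: B.tot_component_closed fmap_closed)

lemma fmap_add:
  "\<lbrakk>\<Phi> \<in> fmap R A B s; a \<in> tot_carrier A n; b \<in> tot_carrier A n\<rbrakk>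
    \<Longrightarrow> \<Phi> n (a \<oplus>\<^bsub>tot_mod R A n\<^esub> b) j = \<Phi> n a j \<oplus>\<^bsub>B j (n + s + j)\<^esub> \<Phi> n b j"
  using mod_hom_add[OF fmap_hom, of \<Phi> a n b]
  by (simp add: tot_mod_simps(1) tot_mod_simps(3)[OF fmap_closed fmap_closed])

lemma fmap_smult:
  "\<lbrakk>\<Phi> \<in> fmap R A B s; r \<in> carrier R; a \<in> tot_carrier A n\<rbrakk>
    \<Longrightarrow> \<Phi> n (r \<odot>\<^bsub>tot_mod R A n\<^esub> a) j = r \<odot>\<^bsub>B j (n + s + j)\<^esub> \<Phi> n a j"
  using mod_hom_smult[OF fmap_hom, of \<Phi> r a n]
  by (simp add: tot_mod_simps(1) tot_mod_simps(4)[OF _ fmap_closed])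

text \<open>Every entry is a composite of linear maps: inclusion of a column, \<Phi>, projection to
  a column, and a sign.\<close>

lemma components_gmap:
  assumes "\<Phi> \<in> fmap R A B s"
  shows "components A B s \<Phi> \<in> gmap R A B s"
proof -
  have "components A B s \<Phi> m p q \<in> mod_hom R (A p q) (B (p - int m) (q - int m + s))" for m p q
  proof -
    \<comment> \<open>This is the total degree of \<open>A p q\<close>; the bidegrees are brought
      into the form \<open>n + i\<close> in which total modules index their columns.\<close>
    define n where "n = q - p"
    then have q: "q = n + p" "q - p = n" and t: "n + p - int m + s = n + s + (p - int m)" by auto
    have incl: "tot_incl A n p (x \<oplus>\<^bsub>A p (n + p)\<^esub> y) = tot_incl A n p x \<oplus>\<^bsub>tot_mod R A n\<^esub> tot_incl A n p y"
      "r \<in> carrier R \<Longrightarrow> tot_incl A n p (r \<odot>\<^bsub>A p (n + p)\<^esub> x) = r \<odot>\<^bsub>tot_mod R A n\<^esub> tot_incl A n p x"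
      if "x \<in> carrier (A p (n + p))" "y \<in> carrier (A p (n + p))" for x y r
      using that mod_hom_add[OF A.tot_incl_hom] mod_hom_smult[OF A.tot_incl_hom] by simp_all
    show ?thesis
      unfolding q components_def t
      by (rule mod_homI)
        (simp_all add: fmap_component_closed[OF assms] B.E.signed_closed A.tot_incl_closed incl
          fmap_add[OF assms] fmap_smult[OF assms] B.E.signed_add B.E.signed_smult)
  qed
  then show ?thesis by (simp add: gmap_def bigraded_map_def algebra_simps)
qed

lemma components_tot_map:
  assumes "\<phi> \<in> gmap R A B s"
  shows "components A B s (tot_map A B s \<phi>) = \<phi>"
proof (intro ext)
  fix m :: nat and p q :: int and x
  define n where "n = q - p"
  define j where "j = p - int m"
  have q: "p = j + int m" "q = n + (j + int m)" and e: "n + (j + int m) - (j + int m) = n"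
    "j + int m - int m = j" "n + (j + int m) - int m + s = n + s + j"
    by (auto simp: n_def j_def)
  show "components A B s (tot_map A B s \<phi>) m p q x = \<phi> m p q x"
  proof (cases "x \<in> carrier (A p q)")
    case False
    moreover have "\<phi> m p q x = undefined"
      using gmap_hom[OF assms, of p j m q "n + s + j"] q False
      by (auto simp: mod_hom_def PiE_def extensional_def)
    ultimately show ?thesis by (simp add: components_def)
  next
    case True
    let ?a = "tot_incl A n (j + int m) x"
    have a: "?a \<in> tot_carrier A n"
      using True unfolding q by (rule A.tot_incl_closed)
    \<comment> \<open>An element supported in column \<open>j + int m\<close> meets only the summand
      with index \<open>m\<close>.\<close>
    have "tot_map A B s \<phi> n ?a j = finsum (B j (n + s + j)) (tot_term \<phi> n j ?a) {m}"
      unfolding tot_map_supp_sum[OF a]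
      by (rule B.E.supp_sum_eq)
        (auto intro: tot_term_closed assms a intro!: tot_term_zero, auto simp: tot_incl_def)
    also have "\<dots> = tot_term \<phi> n j ?a m"
      using tot_term_closed[OF assms a] by simp
    also have "\<dots> = signed (B j (n + s + j)) (int m * n) (\<phi> m p q x)"
      by (simp add: tot_term_def tot_incl_def q)
    \<comment> \<open>The signs of \<open>components\<close> and of \<open>tot_map\<close> have the
      same exponent and cancel.\<close>
    finally show ?thesis
      using True gmap_tot_closed[OF assms a, of m j]
      unfolding components_def q e
      by (simp add: B.E.signed_signed tot_incl_def) (simp add: signed_even)
  qed
qed

text \<open>The columns of \<open>a\<close> from \<open>j + int N\<close> on vanish, and what lies
  below \<open>j\<close> forms an element of the filtration step \<open>j - 1\<close>, which \<Phi>
  preserves. The induction splits off the top column, so \<Phi> is never exchanged with an infinite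
  sum.\<close>

lemma fmap_eq_finsum:
  assumes "\<Phi> \<in> fmap R A B s" "a \<in> column_filt A p n" "p < j + int N"
  shows "\<Phi> n a j = finsum (B j (n + s + j))
    (\<lambda>m. \<Phi> n (tot_incl A n (j + int m) (a (j + int m))) j) {..<N}"
  using assms(2,3)
proof (induction N arbitrary: a p)
  \<comment> \<open>Now \<open>p < j\<close>, and \<Phi> sends \<open>a\<close> into the filtration
    step \<open>p\<close>, whose elements vanish at \<open>j\<close>.\<close>
  case 0
  then show ?case
    using fmap_filt[OF assms(1) 0(1)] by (simp add: column_filt_iff)
next
  case (Suc N)
  let ?i = "j + int N"
  \<comment> \<open>\<open>b\<close> is \<open>a\<close> without its top column
    \<open>j + int N\<close>. It lies in the step \<open>j + int N - 1\<close>, which is why the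
    induction generalizes \<open>p\<close>.\<close>
  define b where "b = (\<lambda>k. if k < ?i then a k else \<zero>\<^bsub>A k (n + k)\<^esub>)"
  have b: "b \<in> column_filt A (?i - 1) n"
    using Suc.prems by (auto simp: column_filt_iff b_def)
  have a_i: "a i \<in> carrier (A i (n + i))" for i
    using Suc.prems by (simp add: column_filt_iff)
  let ?c = "tot_incl A n ?i (a ?i)"
  have b': "b \<in> tot_carrier A n" and c: "?c \<in> tot_carrier A n"
    using b column_filt_subset A.tot_incl_closed a_i by blast+
  have "a = b \<oplus>\<^bsub>tot_mod R A n\<^esub> ?c"
    unfolding tot_mod_simps(3)[OF b' c]
    using Suc.prems a_i
    by (auto simp: fun_eq_iff b_def tot_incl_def column_filt_iff)
  then have "\<Phi> n a j = \<Phi> n b j \<oplus>\<^bsub>B j (n + s + j)\<^esub> \<Phi> n ?c j"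
    using fmap_add[OF assms(1) b' c] by simp
  moreover have closed': "\<Phi> n (tot_incl A n (j + int m) (a (j + int m))) j \<in> carrier (B j (n + s + j))" for m
    by (intro fmap_component_closed[OF assms(1)] A.tot_incl_closed a_i)
  moreover have "\<Phi> n b j = finsum (B j (n + s + j))
      (\<lambda>m. \<Phi> n (tot_incl A n (j + int m) (b (j + int m))) j) {..<N}"
    by (rule Suc.IH[OF b]) simp
  moreover have "\<dots> = finsum (B j (n + s + j))
      (\<lambda>m. \<Phi> n (tot_incl A n (j + int m) (a (j + int m))) j) {..<N}"
    using closed' by (intro B.E.M.add.finprod_cong') (auto simp: b_def)
  ultimately show ?case
    by (simp add: lessThan_Suc B.E.M.a_comm B.E.M.finsum_closed Pi_def)
qed

lemma tot_map_components:
  assumes "\<Phi> \<in> fmap R A B s"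
  shows "tot_map A B s (components A B s \<Phi>) = \<Phi>"
proof (intro ext)
  fix n a j
  note g = components_gmap[OF assms]
  show "tot_map A B s (components A B s \<Phi>) n a j = \<Phi> n a j"
  proof (cases "a \<in> tot_carrier A n")
    case False
    then show ?thesis
      using fmap_hom[OF assms, of n]
      by (auto simp: tot_map_def mod_hom_def PiE_def extensional_def tot_mod_simps)
  next
    case True
    then obtain p where p: "a \<in> column_filt A p n"
      unfolding tot_carrier_eq_Union by blast
    obtain N where N: "p < j + int N"
      by (rule that[of "nat (p - j + 1)"]) simp
    have closed: "\<Phi> n (tot_incl A n (j + int m) (a (j + int m))) j \<in> carrier (B j (n + s + j))" for m
      by (intro fmap_component_closed[OF assms] A.tot_incl_closed A.tot_component_closed True)
    \<comment> \<open>The signs cancel again, so the finite sums for the total map and for \<Phi>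
      agree term by term.\<close>
    have comp_term: "tot_term (components A B s \<Phi>) n j a m = \<Phi> n (tot_incl A n (j + int m) (a (j + int m))) j" for m
    proof -
      have e: "n + (j + int m) - (j + int m) = n"
        "j + int m - int m = j" "n + (j + int m) - int m + s = n + s + j" by auto
      show ?thesis
        unfolding tot_term_def components_def e
        using A.tot_component_closed[OF True] closed
        by (simp add: B.E.signed_signed) (simp add: signed_even)
    qed
    show ?thesis
      unfolding tot_map_eq_finsum[OF g p N] fmap_eq_finsum[OF assms p N] comp_term ..
  qed
qed

lemma tot_map_bij: "bij_betw (tot_map A B s) (gmap R A B s) (fmap R A B s)"
  by (rule bij_betw_byWitness[where f' = "components A B s"])
    (auto simp: components_tot_map tot_map_components tot_map_fmap components_gmap)

text \<open>This allows equations between families to be checked on their total maps.\<close>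

lemma tot_map_inj:
  "\<lbrakk>\<phi> \<in> gmap R A B s; \<psi> \<in> gmap R A B s; tot_map A B s \<phi> = tot_map A B s \<psi>\<rbrakk> \<Longrightarrow> \<phi> = \<psi>"
  by (metis components_tot_map)

end

section \<open>Composition of total maps as signed convolution\<close>

locale bigraded_triple = AB: bigraded_pair R A B s + BC: bigraded_pair R B C t
  for R :: "('r, 's) ring_scheme" and A :: "('r, 'a) bigraded" and B :: "('r, 'b) bigraded"
    and C :: "('r, 'c) bigraded" and s t :: int
begin

sublocale AC: bigraded_pair R A C "s + t"
  by unfold_locales

lemma gcomp_term_hom:
  assumes "\<psi> \<in> gmap R B C t" "\<phi> \<in> gmap R A B s" "i \<le> m"
  shows "(\<lambda>x\<in>carrier (A p q). signed (C (p - int m) (q - int m + (s + t))) (s * int i)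
      (\<psi> i (p - int (m - i)) (q - int (m - i) + s) (\<phi> (m - i) p q x)))
    \<in> mod_hom R (A p q) (C (p - int m) (q - int m + (s + t)))"
proof -
  have \<phi>: "\<phi> (m - i) p q \<in> mod_hom R (A p q) (B (p - int (m - i)) (q - int (m - i) + s))"
    by (rule AB.gmap_hom[OF assms(2)]) auto
  \<comment> \<open>The bound \<open>i \<le> m\<close> makes \<open>m - i\<close> a true difference,
    so that the two shifts add up to \<open>m\<close>.\<close>
  have \<psi>: "\<psi> i (p - int (m - i)) (q - int (m - i) + s)
    \<in> mod_hom R (B (p - int (m - i)) (q - int (m - i) + s)) (C (p - int m) (q - int m + (s + t)))"
    by (rule BC.gmap_hom[OF assms(1)]) (use assms(3) in \<open>auto simp: of_nat_diff\<close>)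
  show ?thesis
    by (rule mod_homI)
      (simp_all add: mod_hom_closed[OF \<phi>] mod_hom_closed[OF \<psi>] mod_hom_add[OF \<phi>] mod_hom_add[OF \<psi>]
        mod_hom_smult[OF \<phi>] mod_hom_smult[OF \<psi>] BC.B.E.signed_closed BC.B.E.signed_add BC.B.E.signed_smult)
qed

lemma gcomp_gmap:
  assumes "\<psi> \<in> gmap R B C t" "\<phi> \<in> gmap R A B s"
  shows "gcomp A C s t \<psi> \<phi> \<in> gmap R A C (s + t)"
proof -
  have "gcomp A C s t \<psi> \<phi> m p q \<in> mod_hom R (A p q) (C (p - int m) (q - int m + (s + t)))" for m p q
  proof -
    have "(\<lambda>x\<in>carrier (A p q). finsum (C (p - int m) (q - int m + (s + t)))
       (\<lambda>i. (\<lambda>x\<in>carrier (A p q). signed (C (p - int m) (q - int m + (s + t))) (s * int i)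
      (\<psi> i (p - int (m - i)) (q - int (m - i) + s) (\<phi> (m - i) p q x))) x) {..m})
      \<in> mod_hom R (A p q) (C (p - int m) (q - int m + (s + t)))"
      by (intro BC.B.E.finsum_mod_hom gcomp_term_hom assms AB.A.E.module_axioms finite_atMost) simp
    also have "(\<lambda>x\<in>carrier (A p q). finsum (C (p - int m) (q - int m + (s + t)))
       (\<lambda>i. (\<lambda>x\<in>carrier (A p q). signed (C (p - int m) (q - int m + (s + t))) (s * int i)
      (\<psi> i (p - int (m - i)) (q - int (m - i) + s) (\<phi> (m - i) p q x))) x) {..m}) = gcomp A C s t \<psi> \<phi> m p q"
      unfolding gcomp_def Let_def by (rule restrict_ext) simp
    finally show ?thesis .
  qed
  then show ?thesis by (simp add: gmap_def bigraded_map_def algebra_simps)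
qed

text \<open>Both sides are the sum of the same terms \<open>F i l\<close> over
  \<open>i + l < N\<close>: the composite yields the rows, the convolution the antidiagonals, and
  \<open>finsum_triangle\<close> matches them.\<close>

lemma tot_map_gcomp_component:
  assumes \<psi>: "\<psi> \<in> gmap R B C t" and \<phi>: "\<phi> \<in> gmap R A B s" and a: "a \<in> tot_carrier A n"
  shows "tot_map A C (s + t) (gcomp A C s t \<psi> \<phi>) n a j
    = tot_map B C t \<psi> (n + s) (tot_map A B s \<phi> n a) j"
proof -
  obtain p where p: "a \<in> column_filt A p n"
    using a unfolding tot_carrier_eq_Union by blast
  obtain N where N: "p < j + int N"
    by (rule that[of "nat (p - j + 1)"]) simp
  \<comment> \<open>The two sides arrive in the degrees \<open>n + (s + t) + j\<close> and
    \<open>n + s + t + j\<close>, equal integers but different terms; \<open>T\<close> gives both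
    modules one name.\<close>
  define T where "T = C j (n + s + t + j)"
  have T: "C j (n + (s + t) + j) = T"
    by (simp add: T_def add.assoc)
  interpret T: plain_module R T
    unfolding T_def by (rule BC.B.E.plain_module_axioms)
  \<comment> \<open>The contribution of column \<open>j + int i + int l\<close>, sent by \<phi> to
    column \<open>j + int i\<close> and then by \<psi> to column \<open>j\<close>. The sign of
    \<psi> involves \<open>n + s\<close>, the total degree reached after \<phi>.\<close>
  define F where "F i l = signed T (int i * (n + s) + int l * n)
    (\<psi> i (j + int i) (n + s + (j + int i))
      (\<phi> l (j + int i + int l) (n + (j + int i + int l)) (a (j + int i + int l))))" for i l
  have \<phi>_closed: "\<phi> l (j + int i + int l) (n + (j + int i + int l)) (a (j + int i + int l))
      \<in> carrier (B (j + int i) (n + s + (j + int i)))" for i l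
    using AB.gmap_tot_closed[OF \<phi> a] .
  have \<psi>_hom: "\<psi> i (j + int i) (n + s + (j + int i))
      \<in> mod_hom R (B (j + int i) (n + s + (j + int i))) T" for i
    using BC.gmap_hom_tot[OF \<psi>, of i j "n + s"] by (simp add: T_def)
  note \<psi>_closed = mod_hom_closed[OF \<psi>_hom \<phi>_closed]
  have F_closed: "F i l \<in> carrier T" for i l
    unfolding F_def by (intro T.signed_closed \<psi>_closed)
  have "tot_map B C t \<psi> (n + s) (tot_map A B s \<phi> n a) j
      = finsum T (BC.tot_term \<psi> (n + s) j (tot_map A B s \<phi> n a)) {..<N}"
    unfolding T_def by (rule BC.tot_map_eq_finsum[OF \<psi> AB.tot_map_filt[OF \<phi> p] N])
  also have "\<dots> = finsum T (\<lambda>i. finsum T (F i) {..<N - i}) {..<N}"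
  proof (rule T.M.add.finprod_cong', rule refl)
    show "(\<lambda>i. finsum T (F i) {..<N - i}) \<in> {..<N} \<rightarrow> carrier T"
      using F_closed by (auto intro!: T.M.finsum_closed)
    fix i assume "i \<in> {..<N}"
    \<comment> \<open>Seen from column \<open>j + int i\<close>, the bound on the support of
      \<open>a\<close> leaves the shorter range \<open>{..<N - i}\<close>, which makes the double
      sum triangular.\<close>
    then have N': "p < j + int i + int (N - i)"
      using N by (simp add: of_nat_diff)
    have closed: "(\<lambda>l. AB.tot_term \<phi> n (j + int i) a l) \<in> {..<N - i} \<rightarrow> carrier (B (j + int i) (n + s + (j + int i)))"
      using AB.tot_term_closed[OF \<phi> a] by simp
    have term_eq: "\<psi> i (j + int i) (n + s + (j + int i)) (AB.tot_term \<phi> n (j + int i) a l)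
       = signed T (int l * n) (\<psi> i (j + int i) (n + s + (j + int i))
      (\<phi> l (j + int i + int l) (n + (j + int i + int l)) (a (j + int i + int l))))" for l
      unfolding AB.tot_term_def
      by (rule mod_hom_signed[OF AB.B.E.module_axioms T.module_axioms \<psi>_hom \<phi>_closed])
    have "BC.tot_term \<psi> (n + s) j (tot_map A B s \<phi> n a) i
      = signed T (int i * (n + s)) (\<psi> i (j + int i) (n + s + (j + int i))
          (finsum (B (j + int i) (n + s + (j + int i))) (AB.tot_term \<phi> n (j + int i) a) {..<N - i}))"
      unfolding BC.tot_term_def AB.tot_map_eq_finsum[OF \<phi> p N'] by (simp add: T_def)
    also have "\<dots> = signed T (int i * (n + s)) (finsum T (\<lambda>l. signed T (int l * n) (\<psi> i (j + int i) (n + s + (j + int i))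
      (\<phi> l (j + int i + int l) (n + (j + int i + int l)) (a (j + int i + int l))))) {..<N - i})"
      by (subst mod_hom_finsum[OF AB.B.E.module_axioms T.module_axioms \<psi>_hom _ closed]) (simp_all add: term_eq)
    also have "\<dots> = finsum T (\<lambda>l. signed T (int i * (n + s)) (signed T (int l * n) (\<psi> i (j + int i) (n + s + (j + int i))
      (\<phi> l (j + int i + int l) (n + (j + int i + int l)) (a (j + int i + int l)))))) {..<N - i}"
      by (rule T.signed_finsum) (auto intro!: T.signed_closed \<psi>_closed)
    also have "\<dots> = finsum T (F i) {..<N - i}"
      unfolding F_def by (simp add: T.signed_signed \<psi>_closed)
    finally show "BC.tot_term \<psi> (n + s) j (tot_map A B s \<phi> n a) i = finsum T (F i) {..<N - i}" .
  qed
  also have "\<dots> = finsum T (\<lambda>k. finsum T (\<lambda>i. F i (k - i)) {..k}) {..<N}"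
    by (rule T.M.finsum_triangle[symmetric]) (rule F_closed)
  also have "\<dots> = finsum T (AC.tot_term (gcomp A C s t \<psi> \<phi>) n j a) {..<N}"
  proof (rule T.M.add.finprod_cong', rule refl)
    show "AC.tot_term (gcomp A C s t \<psi> \<phi>) n j a \<in> {..<N} \<rightarrow> carrier T"
      using AC.tot_term_closed[OF gcomp_gmap[OF \<psi> \<phi>] a] unfolding T[symmetric] by blast
    fix k
    have T': "C (j + int k - int k) (n + (j + int k) - int k + (s + t)) = T"
      unfolding T[symmetric] by (rule arg_cong2[where f = C]) auto
    have "AC.tot_term (gcomp A C s t \<psi> \<phi>) n j a k
      = signed T (int k * n) (finsum T (\<lambda>i. signed T (s * int i)
       (\<psi> i (j + int k - int (k - i)) (n + (j + int k) - int (k - i) + s)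
          (\<phi> (k - i) (j + int k) (n + (j + int k)) (a (j + int k))))) {..k})"
      unfolding AC.tot_term_def gcomp_def T T' Let_def
      using AB.A.tot_component_closed[OF a] by simp
    also have "\<dots> = finsum T (\<lambda>i. signed T (int k * n) (signed T (s * int i)
       (\<psi> i (j + int k - int (k - i)) (n + (j + int k) - int (k - i) + s)
          (\<phi> (k - i) (j + int k) (n + (j + int k)) (a (j + int k)))))) {..k}"
    proof (rule T.signed_finsum)
      have "signed T (s * int i)
       (\<psi> i (j + int k - int (k - i)) (n + (j + int k) - int (k - i) + s)
          (\<phi> (k - i) (j + int k) (n + (j + int k)) (a (j + int k)))) \<in> carrier T" if "i \<le> k" for i
        using mod_hom_closed[OF gcomp_term_hom[OF \<psi> \<phi> that, of "j + int k" "n + (j + int k)"] AB.A.tot_component_closed[OF a]]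
           AB.A.tot_component_closed[OF a]
        unfolding T' by simp
      then show "(\<lambda>i. signed T (s * int i)
       (\<psi> i (j + int k - int (k - i)) (n + (j + int k) - int (k - i) + s)
          (\<phi> (k - i) (j + int k) (n + (j + int k)) (a (j + int k))))) \<in> {..k} \<rightarrow> carrier T" by simp
    qed simp
    also have "\<dots> = finsum T (\<lambda>i. F i (k - i)) {..k}"
    proof (rule T.M.add.finprod_cong', rule refl)
      show "(\<lambda>i. F i (k - i)) \<in> {..k} \<rightarrow> carrier T" using F_closed by simp
      fix i assume "i \<in> {..k}"
      then have e: "int (k - i) = int k - int i" "j + int k - (int k - int i) = j + int i"
        "n + (j + int k) - (int k - int i) + s = n + s + (j + int i)" "j + int i + (int k - int i) = j + int k"
        by (auto simp: of_nat_diff)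
      have "\<psi> i (j + int i) (n + s + (j + int i))
          (\<phi> (k - i) (j + int k) (n + (j + int k)) (a (j + int k))) \<in> carrier T"
        using \<psi>_closed[of i "k - i"] unfolding e .
      \<comment> \<open>With l = k - i the exponents agree: kn + si = i(n + s) + ln. This accounts
        for the sign in \<open>gcomp\<close>.\<close>
      then show "signed T (int k * n) (signed T (s * int i)
       (\<psi> i (j + int k - int (k - i)) (n + (j + int k) - int (k - i) + s)
          (\<phi> (k - i) (j + int k) (n + (j + int k)) (a (j + int k))))) = F i (k - i)"
        unfolding F_def e
        by (simp add: T.signed_signed algebra_simps)
    qed
    finally show "finsum T (\<lambda>i. F i (k - i)) {..k} = AC.tot_term (gcomp A C s t \<psi> \<phi>) n j a k" by simp
  qed
  also have "\<dots> = tot_map A C (s + t) (gcomp A C s t \<psi> \<phi>) n a j"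
    unfolding T[symmetric] by (rule AC.tot_map_eq_finsum[OF gcomp_gmap[OF \<psi> \<phi>] p N, symmetric])
  finally show ?thesis ..
qed

lemma tot_map_gcomp:
  assumes "\<psi> \<in> gmap R B C t" "\<phi> \<in> gmap R A B s"
  shows "tot_map A C (s + t) (gcomp A C s t \<psi> \<phi>) n
    = (\<lambda>a\<in>tot_carrier A n. tot_map B C t \<psi> (n + s) (tot_map A B s \<phi> n a))"
proof
  fix a
  show "tot_map A C (s + t) (gcomp A C s t \<psi> \<phi>) n a
    = (\<lambda>a\<in>tot_carrier A n. tot_map B C t \<psi> (n + s) (tot_map A B s \<phi> n a)) a"
  proof (cases "a \<in> tot_carrier A n")
    case True
    then show ?thesis using tot_map_gcomp_component[OF assms] by auto
  next
    case False
    then show ?thesis by (simp add: tot_map_def)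
  qed
qed

end

section \<open>Vanishing of a family in terms of its total map\<close>

lemma gmap_extensional:
  "\<lbrakk>\<phi> \<in> gmap R A B s; x \<notin> carrier (A p q)\<rbrakk> \<Longrightarrow> \<phi> m p q x = undefined"
  unfolding gmap_def bigraded_map_def mod_hom_def by (auto simp: PiE_def extensional_def)

lemma gcomp_extensional: "x \<notin> carrier (A p q) \<Longrightarrow> gcomp A C s t \<psi> \<phi> m p q x = undefined"
  by (simp add: gcomp_def)

context bigraded_pair
begin

text \<open>The zero element of \<open>gmap\<close>; it is restricted to the carriers because
  homomorphisms are \<open>undefined\<close> elsewhere.\<close>

definition zero_fam :: "nat \<Rightarrow> int \<Rightarrow> int \<Rightarrow> 'a \<Rightarrow> 'b" where
  "zero_fam m p q = (\<lambda>x\<in>carrier (A p q). \<zero>\<^bsub>B (p - int m) (q - int m + s)\<^esub>)"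

lemma zero_fam_gmap: "zero_fam \<in> gmap R A B s"
proof -
  have "zero_fam m p q \<in> mod_hom R (A p q) (B (p - int m) (q - int m + s))" for m p q
    unfolding zero_fam_def by (rule mod_homI) simp_all
  then show ?thesis by (simp add: gmap_def bigraded_map_def algebra_simps)
qed

lemma tot_map_zero_fam:
  assumes "a \<in> tot_carrier A n"
  shows "tot_map A B s zero_fam n a = (\<lambda>j. \<zero>\<^bsub>B j (n + s + j)\<^esub>)"
proof
  fix j
  have "tot_term zero_fam n j a m = \<zero>\<^bsub>B j (n + s + j)\<^esub>" for m
  proof -
    have "j + int m - int m = j" "n + (j + int m) - int m + s = n + s + j" by auto
    then show ?thesis
      using A.tot_component_closed[OF assms] by (simp only: tot_term_def zero_fam_def restrict_apply B.E.signed_zero if_True)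
  qed
  then show "tot_map A B s zero_fam n a j = \<zero>\<^bsub>B j (n + s + j)\<^esub>"
    unfolding tot_map_supp_sum[OF assms] supp_sum_def by simp
qed

text \<open>\<open>zero_fam\<close> has zero total map, and injectivity of \<open>tot_map\<close>
  leads from total maps back to families.\<close>

lemma gmap_eq_zero_iff:
  assumes "\<phi> \<in> gmap R A B s"
  shows "(\<forall>m p q. \<forall>x\<in>carrier (A p q). \<phi> m p q x = \<zero>\<^bsub>B (p - int m) (q - int m + s)\<^esub>)
    \<longleftrightarrow> (\<forall>n. \<forall>a\<in>tot_carrier A n. tot_map A B s \<phi> n a = (\<lambda>j. \<zero>\<^bsub>B j (n + s + j)\<^esub>))"
    (is "?L \<longleftrightarrow> ?R")
proof -
  have "?L \<longleftrightarrow> \<phi> = zero_fam"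
    using gmap_extensional[OF assms] unfolding fun_eq_iff zero_fam_def restrict_def by metis
  also have "\<dots> \<longleftrightarrow> tot_map A B s \<phi> = tot_map A B s zero_fam"
    using tot_map_inj[OF assms zero_fam_gmap] by blast
  also have "\<dots> \<longleftrightarrow> ?R"
  proof
    assume "tot_map A B s \<phi> = tot_map A B s zero_fam"
    then show ?R by (simp add: tot_map_zero_fam)
  next
    assume ?R
    then have "tot_map A B s \<phi> n a = tot_map A B s zero_fam n a" for n a
      by (cases "a \<in> tot_carrier A n") (simp add: tot_map_zero_fam, simp add: tot_map_def)
    then show "tot_map A B s \<phi> = tot_map A B s zero_fam" by blast
  qed
  finally show ?thesis .
qed

end

section \<open>Totalization of twisted complexes\<close>

lemma tot_diff_eq: "tot_diff X = tot_map (tmod X) (tmod X) 1 (tdiff X)"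
  by (intro ext) (simp add: tot_diff_def tot_map_def)

lemma tot_mor_eq: "tot_mor X Y f = tot_map (tmod X) (tmod Y) 0 f"
  by (intro ext) (simp add: tot_mor_def tot_map_def)

lemma twisted_complex_gmapD:
  assumes "twisted_complex R X"
  shows "bigraded_module R (tmod X)" "tdiff X \<in> gmap R (tmod X) (tmod X) 1"
  using assms by (simp_all add: twisted_complex_def gmap_def Let_def)

text \<open>The sum in the equation for the d_m is \<open>gcomp\<close> of \<open>tdiff X\<close>
  with itself for \<open>s = t = 1\<close>, where \<open>s = 1\<close> produces the sign (-1)^i. By
  \<open>tot_map_gcomp\<close> its total map is the square of the total differential.\<close>

lemma twisted_complex_iff:
  "twisted_complex R X \<longleftrightarrow> bigraded_module R (tmod X) \<and> tdiff X \<in> gmap R (tmod X) (tmod X) 1 \<and>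
    (\<forall>n. \<forall>a\<in>tot_carrier (tmod X) n. tot_diff X (n + 1) (tot_diff X n a) = (\<lambda>j. \<zero>\<^bsub>tmod X j (n + 2 + j)\<^esub>))"
proof (cases "bigraded_module R (tmod X) \<and> tdiff X \<in> gmap R (tmod X) (tmod X) 1")
  case True
  let ?A = "tmod X" and ?d = "tdiff X"
  have d: "?d \<in> gmap R ?A ?A 1" using True by simp
  interpret bigraded_triple R ?A ?A ?A 1 1
    using True by unfold_locales simp_all
  have "twisted_complex R X \<longleftrightarrow> (\<forall>m p q. \<forall>x\<in>carrier (?A p q).
      gcomp ?A ?A 1 1 ?d ?d m p q x = \<zero>\<^bsub>?A (p - int m) (q - int m + (1 + 1))\<^esub>)"
    using True by (simp add: twisted_complex_def gcomp_def gmap_def Let_def)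
  also have "\<dots> \<longleftrightarrow> (\<forall>n. \<forall>a\<in>tot_carrier ?A n. tot_diff X (n + 1) (tot_diff X n a) = (\<lambda>j. \<zero>\<^bsub>?A j (n + (1 + 1) + j)\<^esub>))"
    unfolding AC.gmap_eq_zero_iff[OF gcomp_gmap[OF d d]] tot_map_gcomp[OF d d] tot_diff_eq by simp
  finally show ?thesis using True by simp
next
  case False
  then show ?thesis using twisted_complex_gmapD by blast
qed

text \<open>Both sides of the morphism equation are convolutions, with s = 0, t = 1 if
  \<open>f\<close> acts first and s = 1, t = 0 if the differential acts first; only the latter
  carries signs. Their total maps are the two composites to be compared.\<close>

lemma twisted_mor_iff:
  assumes "twisted_complex R X" "twisted_complex R Y"
  shows "f \<in> twisted_mor R X Y \<longleftrightarrow> f \<in> gmap R (tmod X) (tmod Y) 0 \<and>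
    (\<forall>n. \<forall>a\<in>tot_carrier (tmod X) n.
      tot_mor X Y f (n + 1) (tot_diff X n a) = tot_diff Y n (tot_mor X Y f n a))"
proof (cases "f \<in> gmap R (tmod X) (tmod Y) 0")
  case True
  note X = twisted_complex_gmapD[OF assms(1)] and Y = twisted_complex_gmapD[OF assms(2)]
  let ?A = "tmod X" and ?B = "tmod Y"
  interpret L: bigraded_triple R ?A ?B ?B 0 1
    using X Y by unfold_locales simp_all
  interpret N: bigraded_triple R ?A ?A ?B 1 0
    using X Y by unfold_locales simp_all
  let ?l = "gcomp ?A ?B 0 1 (tdiff Y) f" and ?r = "gcomp ?A ?B 1 0 f (tdiff X)"
  have l: "?l \<in> gmap R ?A ?B (0 + 1)" and r: "?r \<in> gmap R ?A ?B (0 + 1)"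
    using L.gcomp_gmap[OF Y(2) True] N.gcomp_gmap[OF True X(2)] by simp_all
  have "f \<in> twisted_mor R X Y \<longleftrightarrow> (\<forall>m p q. \<forall>x\<in>carrier (?A p q). ?l m p q x = ?r m p q x)"
    using True by (simp add: twisted_mor_def gcomp_def gmap_def Let_def signed_even)
  \<comment> \<open>Off the carriers both families are \<open>undefined\<close>, so agreement on the
    carriers is equality.\<close>
  also have "\<dots> \<longleftrightarrow> ?l = ?r"
    using gcomp_extensional[of _ ?A] unfolding fun_eq_iff by metis
  also have "\<dots> \<longleftrightarrow> tot_map ?A ?B (0 + 1) ?l = tot_map ?A ?B (1 + 0) ?r"
    using L.AC.tot_map_inj[OF l r] by auto
  also have "\<dots> \<longleftrightarrow> (\<forall>n a. (\<lambda>a\<in>tot_carrier ?A n. tot_diff Y n (tot_mor X Y f n a)) a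
      = (\<lambda>a\<in>tot_carrier ?A n. tot_mor X Y f (n + 1) (tot_diff X n a)) a)"
    unfolding fun_eq_iff[of "tot_map _ _ _ _"] L.tot_map_gcomp[OF Y(2) True] N.tot_map_gcomp[OF True X(2)]
      tot_mor_eq tot_diff_eq fun_eq_iff[of "restrict _ _"] by simp
  also have "\<dots> \<longleftrightarrow> (\<forall>n. \<forall>a\<in>tot_carrier ?A n.
      tot_mor X Y f (n + 1) (tot_diff X n a) = tot_diff Y n (tot_mor X Y f n a))"
    by (auto simp: restrict_def)
  finally show ?thesis using True by simp
next
  case False
  then show ?thesis by (auto simp: twisted_mor_def gmap_def)
qed

lemma twisted_comp_eq: "twisted_comp X Y Z g f = gcomp (tmod X) (tmod Z) 0 0 g f"
  by (intro ext) (simp add: twisted_comp_def gcomp_def signed_even Let_def)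

lemma twisted_id_gmap:
  assumes "bigraded_module R (tmod X)"
  shows "twisted_id X \<in> gmap R (tmod X) (tmod X) 0"
proof -
  interpret bigraded R "tmod X" by (rule bigraded.intro) fact
  have "twisted_id X m p q \<in> mod_hom R (tmod X p q) (tmod X (p - int m) (q - int m))" for m p q
    unfolding twisted_id_def by (rule mod_homI) simp_all
  then show ?thesis by (simp add: gmap_def bigraded_map_def)
qed

lemma tot_mor_twisted_id:
  assumes "bigraded_module R (tmod X)"
  shows "tot_mor X X (twisted_id X) = filtered_id (tot_complex R X)"
proof (intro ext)
  interpret bigraded_pair R "tmod X" "tmod X" 0
    using assms by unfold_locales
  fix n a j
  note id = twisted_id_gmap[OF assms]
  show "tot_mor X X (twisted_id X) n a j = filtered_id (tot_complex R X) n a j"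
  proof (cases "a \<in> tot_carrier (tmod X) n")
    case True
    \<comment> \<open>Only the summand for \<open>m = 0\<close> survives, and its sign exponent is
      0.\<close>
    have "tot_mor X X (twisted_id X) n a j
        = finsum (tmod X j (n + 0 + j)) (tot_term (twisted_id X) n j a) {0}"
      unfolding tot_mor_eq tot_map_supp_sum[OF True]
    proof (rule A.E.supp_sum_eq)
      fix m :: nat
      assume "m \<notin> {0}"
      then show "tot_term (twisted_id X) n j a m = \<zero>\<^bsub>tmod X j (n + 0 + j)\<^esub>"
        using A.E.signed_zero[of j "n + j"]
        by (simp add: tot_term_def twisted_id_def A.tot_component_closed[OF True])
    qed (rule tot_term_closed[OF id True] finite.intros)+
    also have "\<dots> = tot_term (twisted_id X) n j a 0"
      using tot_term_closed[OF id True] by simp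
    also have "\<dots> = a j"
      by (simp add: tot_term_def twisted_id_def A.tot_component_closed[OF True] signed_even)
    finally show ?thesis
      using True by (simp add: filtered_id_def tot_complex_def tot_mod_simps)
  next
    case False
    then show ?thesis
      by (simp add: tot_mor_def filtered_id_def tot_complex_def tot_mod_simps)
  qed
qed

lemma tot_mor_comp:
  assumes "bigraded_module R (tmod X)" "bigraded_module R (tmod Y)" "bigraded_module R (tmod Z)"
    "f \<in> gmap R (tmod X) (tmod Y) 0" "g \<in> gmap R (tmod Y) (tmod Z) 0"
  shows "twisted_comp X Y Z g f \<in> gmap R (tmod X) (tmod Z) 0"
    and "tot_mor X Z (twisted_comp X Y Z g f)
      = filtered_comp (tot_complex R X) (tot_mor Y Z g) (tot_mor X Y f)"
proof -
  interpret bigraded_triple R "tmod X" "tmod Y" "tmod Z" 0 0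
    using assms by unfold_locales
  show "twisted_comp X Y Z g f \<in> gmap R (tmod X) (tmod Z) 0"
    using gcomp_gmap[OF assms(5,4)] by (simp add: twisted_comp_eq)
  show "tot_mor X Z (twisted_comp X Y Z g f)
      = filtered_comp (tot_complex R X) (tot_mor Y Z g) (tot_mor X Y f)"
    using tot_map_gcomp[OF assms(5,4)]
    by (intro ext) (simp add: twisted_comp_eq tot_mor_eq filtered_comp_def tot_complex_def tot_mod_simps)
qed

section \<open>Split filtered complexes\<close>

text \<open>The conditions on the modules and on the filtration hold for every column filtration,
  exhaustion being \<open>tot_carrier_eq_Union\<close>. What is left concerns the
  differential.\<close>

lemma filtered_complex_split_iff:
  assumes "bigraded_module R A" "cmod K = tot_mod R A" "cfilt K = column_filt A"
  shows "filtered_complex R K \<longleftrightarrow> cdiff K \<in> fmap R A A 1 \<and>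
    (\<forall>n. \<forall>a\<in>tot_carrier A n. cdiff K (n + 1) (cdiff K n a) = (\<lambda>j. \<zero>\<^bsub>A j (n + 2 + j)\<^esub>))"
proof -
  interpret bigraded R A by (rule bigraded.intro) fact
  show ?thesis
    unfolding filtered_complex_def assms(2,3) fmap_def
    by (auto simp: tot_mod_simps tot_is_module column_filt_submodule column_filt_mono
        tot_carrier_eq_Union[symmetric])
qed

lemma filtered_mor_split_iff:
  assumes "cmod K = tot_mod R A" "cfilt K = column_filt A"
    and "cmod L = tot_mod R B" "cfilt L = column_filt B"
  shows "f \<in> filtered_mor R K L \<longleftrightarrow> f \<in> fmap R A B 0 \<and>
    (\<forall>n. \<forall>a\<in>tot_carrier A n. f (n + 1) (cdiff K n a) = cdiff L n (f n a))"
  unfolding filtered_mor_def fmap_def assms by (auto simp: tot_mod_simps)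

lemma tot_complex_simps:
  "cmod (tot_complex R X) = tot_mod R (tmod X)"
  "cdiff (tot_complex R X) = tot_diff X"
  "cfilt (tot_complex R X) = column_filt (tmod X)"
  by (simp_all add: tot_complex_def)

lemma tot_complex_split:
  assumes "twisted_complex R X"
  shows "split_filtered R (tmod X, tot_complex R X)"
proof -
  note X = twisted_complex_gmapD[OF assms]
  interpret bigraded_pair R "tmod X" "tmod X" 1
    using X by unfold_locales
  have "filtered_complex R (tot_complex R X)"
    using assms tot_map_fmap[OF X(2)]
    unfolding twisted_complex_iff filtered_complex_split_iff[OF X(1) tot_complex_simps(1,3)]
    by (simp add: tot_complex_simps tot_diff_eq)
  then show ?thesis
    using X by (simp add: split_filtered_def tot_complex_simps)
qed

text \<open>The inverse keeps the splitting and takes the matrix entries of the differential; since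
  the differential squares to zero, \<open>twisted_complex_iff\<close> makes them a twisted
  complex.\<close>

lemma tot_split_bij:
  fixes R :: "('r, 's) ring_scheme"
  shows "bij_betw (\<lambda>X :: ('r, 'a) twisted. (tmod X, tot_complex R X))
    {X. twisted_complex R X} {S. split_filtered R S}"
proof (rule bij_betw_byWitness[where
      f' = "\<lambda>S. \<lparr>tmod = fst S, tdiff = components (fst S) (fst S) 1 (cdiff (snd S))\<rparr>"])
  show "\<forall>X\<in>{X :: ('r, 'a) twisted. twisted_complex R X}. \<lparr>tmod = fst (tmod X, tot_complex R X),
      tdiff = components (fst (tmod X, tot_complex R X)) (fst (tmod X, tot_complex R X)) 1
        (cdiff (snd (tmod X, tot_complex R X)))\<rparr> = X"
  proof
    fix X :: "('r, 'a) twisted" assume "X \<in> {X. twisted_complex R X}"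
    then have X: "bigraded_module R (tmod X)" "tdiff X \<in> gmap R (tmod X) (tmod X) 1"
      using twisted_complex_gmapD by blast+
    interpret bigraded_pair R "tmod X" "tmod X" 1
      using X by unfold_locales
    show "\<lparr>tmod = fst (tmod X, tot_complex R X),
      tdiff = components (fst (tmod X, tot_complex R X)) (fst (tmod X, tot_complex R X)) 1
        (cdiff (snd (tmod X, tot_complex R X)))\<rparr> = X"
      by (simp add: tot_complex_simps tot_diff_eq components_tot_map X)
  qed
  have inverse: "twisted_complex R \<lparr>tmod = A, tdiff = components A A 1 (cdiff K)\<rparr> \<and>
      tot_complex R \<lparr>tmod = A, tdiff = components A A 1 (cdiff K)\<rparr> = K"
    if "split_filtered R (A, K)" for A :: "('r, 'a) bigraded" and K
  proof -
    let ?X = "\<lparr>tmod = A, tdiff = components A A 1 (cdiff K)\<rparr>"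
    have K: "bigraded_module R A" "filtered_complex R K" "cmod K = tot_mod R A" "cfilt K = column_filt A"
      using that by (simp_all add: split_filtered_def)
    interpret bigraded_pair R A A 1
      using K by unfold_locales
    have d: "cdiff K \<in> fmap R A A 1" and
      d2: "\<forall>n. \<forall>a\<in>tot_carrier A n. cdiff K (n + 1) (cdiff K n a) = (\<lambda>j. \<zero>\<^bsub>A j (n + 2 + j)\<^esub>)"
      using K filtered_complex_split_iff[OF K(1,3,4)] by simp_all
    have "tot_diff ?X = cdiff K"
      by (simp add: tot_diff_eq tot_map_components d)
    moreover from this have "twisted_complex R ?X"
      unfolding twisted_complex_iff using K d d2 components_gmap by simp
    ultimately show ?thesis
      using K by (simp add: tot_complex_def)
  qed
  then show "\<forall>S\<in>{S :: ('r, 'a) split. split_filtered R S}. (tmod \<lparr>tmod = fst S, tdiff = components (fst S) (fst S) 1 (cdiff (snd S))\<rparr>,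
      tot_complex R \<lparr>tmod = fst S, tdiff = components (fst S) (fst S) 1 (cdiff (snd S))\<rparr>) = S"
    and "(\<lambda>S. \<lparr>tmod = fst S, tdiff = components (fst S) (fst S) 1 (cdiff (snd S))\<rparr>) ` {S :: ('r, 'a) split. split_filtered R S}
      \<subseteq> {X. twisted_complex R X}"
    by auto
  show "(\<lambda>X :: ('r, 'a) twisted. (tmod X, tot_complex R X)) ` {X. twisted_complex R X} \<subseteq> {S. split_filtered R S}"
    using tot_complex_split by blast
qed

text \<open>This is \<open>tot_map_bij\<close> for \<open>s = 0\<close>, cut down on both sides by
  compatibility with the differentials, which \<open>twisted_mor_iff\<close> and
  \<open>filtered_mor_split_iff\<close> express by the same equation.\<close>

lemma tot_mor_bij:
  assumes "twisted_complex R X" "twisted_complex R Y"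
  shows "bij_betw (tot_mor X Y) (twisted_mor R X Y) (filtered_mor R (tot_complex R X) (tot_complex R Y))"
proof -
  note X = twisted_complex_gmapD[OF assms(1)] and Y = twisted_complex_gmapD[OF assms(2)]
  interpret bigraded_pair R "tmod X" "tmod Y" 0
    using X Y by unfold_locales
  have bij: "bij_betw (tot_mor X Y) (gmap R (tmod X) (tmod Y) 0) (fmap R (tmod X) (tmod Y) 0)"
    using tot_map_bij by (simp add: tot_mor_eq[abs_def])
  note iff = twisted_mor_iff[OF assms] filtered_mor_split_iff[OF tot_complex_simps(1,3) tot_complex_simps(1,3)]
    tot_complex_simps(2)
  show ?thesis
    unfolding bij_betw_def
  proof
    show "inj_on (tot_mor X Y) (twisted_mor R X Y)"
      using bij by (rule inj_on_subset[OF bij_betw_imp_inj_on]) (simp add: iff subset_iff)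
    show "tot_mor X Y ` twisted_mor R X Y = filtered_mor R (tot_complex R X) (tot_complex R Y)"
      unfolding set_eq_iff image_iff Bex_def iff
      using bij_betw_imp_surj_on[OF bij, symmetric] by auto
  qed
qed

text \<open>The module \<open>A i j\<close> is the set of \<open>i\<close>-th components of elements of total degree
  \<open>j - i\<close>, with the induced operations.\<close>

lemma tot_mod_inj:
  assumes A: "bigraded_module R A" and B: "bigraded_module R B" and eq: "tot_mod R A = tot_mod R B"
  shows "A = B"
proof (intro ext)
  interpret A: bigraded R A by (rule bigraded.intro) fact
  interpret B: bigraded R B by (rule bigraded.intro) fact
  have carrier: "tot_carrier A n = tot_carrier B n" for n
    using tot_mod_simps(1)[of R A n] tot_mod_simps(1)[of R B n] eq by simp
  have zero: "\<zero>\<^bsub>A i (n + i)\<^esub> = \<zero>\<^bsub>B i (n + i)\<^esub>" for n i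
    using tot_mod_simps(2)[of R A n] tot_mod_simps(2)[of R B n] eq by (metis)
  fix i j :: int
  define n where "n = j - i"
  have j: "j = n + i" by (simp add: n_def)
  have incl: "tot_incl A n i x = tot_incl B n i x" for x
    by (simp add: tot_incl_def fun_eq_iff zero)
  have sub: "carrier (A i j) = carrier (B i j)"
  proof -
    have "x \<in> carrier (B i (n + i))" if "x \<in> carrier (A i (n + i))" for x
      using A.tot_incl_closed[OF that] carrier B.tot_component_closed[of "tot_incl A n i x" n i]
      by (simp add: tot_incl_def)
    moreover have "x \<in> carrier (A i (n + i))" if "x \<in> carrier (B i (n + i))" for x
      using B.tot_incl_closed[OF that] carrier A.tot_component_closed[of "tot_incl B n i x" n i]
      by (simp add: tot_incl_def)
    ultimately show ?thesis unfolding j by blast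
  qed
  have add: "x \<oplus>\<^bsub>A i j\<^esub> y = x \<oplus>\<^bsub>B i j\<^esub> y" if "x \<in> carrier (A i j)" "y \<in> carrier (A i j)" for x y
  proof -
    have xy: "tot_incl A n i x \<in> tot_carrier A n" "tot_incl A n i y \<in> tot_carrier A n"
      using that A.tot_incl_closed unfolding j by blast+
    have "(tot_incl A n i x \<oplus>\<^bsub>tot_mod R A n\<^esub> tot_incl A n i y) i
        = (tot_incl A n i x \<oplus>\<^bsub>tot_mod R B n\<^esub> tot_incl A n i y) i"
      by (simp add: eq)
    then show ?thesis
      unfolding tot_mod_simps(3)[OF xy] tot_mod_simps(3)[OF xy[unfolded carrier]] j
      by (simp add: tot_incl_def)
  qed
  have smult: "r \<odot>\<^bsub>A i j\<^esub> x = r \<odot>\<^bsub>B i j\<^esub> x" if "r \<in> carrier R" "x \<in> carrier (A i j)" for r x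
  proof -
    have x: "tot_incl A n i x \<in> tot_carrier A n"
      using that A.tot_incl_closed unfolding j by blast+
    have "(r \<odot>\<^bsub>tot_mod R A n\<^esub> tot_incl A n i x) i = (r \<odot>\<^bsub>tot_mod R B n\<^esub> tot_incl A n i x) i"
      by (simp add: eq)
    then show ?thesis
      unfolding tot_mod_simps(4)[OF that(1) x] tot_mod_simps(4)[OF that(1) x[unfolded carrier]] j
      by (simp add: tot_incl_def)
  qed
  \<comment> \<open>Both modules are normalized, so agreement on the common carrier makes the
    records equal.\<close>
  have "std_module R (A i j) = std_module R (B i j)"
    unfolding std_module_def sub[symmetric]
    using add smult zero[of i n] by (auto simp: j intro!: restrict_ext)
  then show "A i j = B i j"
    using A B by (simp add: bigraded_module_def is_module_def)
qed

section \<open>Categories\<close>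

text \<open>The inverse functor is assembled from inverses on objects and on hom-sets. Its
  compatibility with identities and composites holds after applying \<open>F\<close>, which is
  injective on hom-sets.\<close>

lemma isomorphism_of_categoriesI:
  assumes F: "is_functor C D F"
    and ob: "bij_betw (fobj F) (Ob C) (Ob D)"
    and mor: "\<And>X Y. \<lbrakk>X \<in> Ob C; Y \<in> Ob C\<rbrakk>
      \<Longrightarrow> bij_betw (fmor F X Y) (Mor C X Y) (Mor D (fobj F X) (fobj F Y))"
  shows "isomorphism_of_categories C D F"
proof -
  interpret F: is_functor C D F by fact
  define g where "g = inv_into (Ob C) (fobj F)"
  define h where "h U V = inv_into (Mor C (g U) (g V)) (fmor F (g U) (g V))" for U V
  define G where "G = \<lparr>fobj = g, fmor = h\<rparr>"
  have g: "g U \<in> Ob C" "fobj F (g U) = U" if "U \<in> Ob D" for U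
    using ob that by (auto simp: g_def bij_betw_def inv_into_into f_inv_into_f)
  have gF: "g (fobj F X) = X" if "X \<in> Ob C" for X
    using ob that by (simp add: g_def bij_betw_inv_into_left)
  have h: "h U V k \<in> Mor C (g U) (g V)" "fmor F (g U) (g V) (h U V k) = k"
    if "U \<in> Ob D" "V \<in> Ob D" "k \<in> Mor D U V" for U V k
  proof -
    have "bij_betw (fmor F (g U) (g V)) (Mor C (g U) (g V)) (Mor D U V)"
      using mor[OF g(1) g(1)] g(2) that by metis
    then show "h U V k \<in> Mor C (g U) (g V)" "fmor F (g U) (g V) (h U V k) = k"
      using that by (auto simp: h_def bij_betw_def inv_into_into f_inv_into_f)
  qed
  have faithful: "k = k'" if "X \<in> Ob C" "Y \<in> Ob C" "k \<in> Mor C X Y" "k' \<in> Mor C X Y"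
    "fmor F X Y k = fmor F X Y k'" for X Y k k'
    using mor[OF that(1,2)] that by (auto simp: bij_betw_def inj_on_def)
  have "is_functor D C G"
  proof (unfold_locales, goal_cases)
    case (3 U)
    show ?case
      by (rule faithful[of "g U" "g U"])
        (use 3 in \<open>simp_all add: G_def g h F.ident F.dom.ident_mor F.cod.ident_mor\<close>)
  next
    case (4 U V W k l)
    then have kl: "Comp D U V W l k \<in> Mor D U W" by (metis F.cod.comp_mor)
    show ?case
      by (rule faithful[of "g U" "g W"])
        (use 4 kl in \<open>simp_all add: G_def g h F.comp F.dom.comp_mor[where Y = "g V"]\<close>)
  qed (simp_all add: G_def g h)
  moreover have "functor_eq C (comp_functor G F) id_functor"
  proof -
    have "h (fobj F X) (fobj F Y) (fmor F X Y f) = f"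
      if "X \<in> Ob C" "Y \<in> Ob C" "f \<in> Mor C X Y" for X Y f
      using bij_betw_inv_into_left[OF mor] that by (simp add: h_def gF)
    then show ?thesis
      by (simp add: functor_eq_def comp_functor_def id_functor_def G_def gF)
  qed
  moreover have "functor_eq D (comp_functor F G) id_functor"
    by (simp add: functor_eq_def comp_functor_def id_functor_def G_def g h)
  ultimately show ?thesis
    using F unfolding isomorphism_of_categories_def by blast
qed

text \<open>Unit laws and associativity in \<open>C\<close> are pulled back from \<open>D\<close>
  along the injective maps on hom-sets. For twisted complexes this replaces a direct computation
  with nested sums.\<close>

lemma faithful_functorI:
  assumes D: "category D"
    and obj: "\<And>X. X \<in> Ob C \<Longrightarrow> fobj F X \<in> Ob D"
    and inj: "\<And>X Y. \<lbrakk>X \<in> Ob C; Y \<in> Ob C\<rbrakk> \<Longrightarrow> inj_on (fmor F X Y) (Mor C X Y)"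
    and mor: "\<And>X Y f. \<lbrakk>X \<in> Ob C; Y \<in> Ob C; f \<in> Mor C X Y\<rbrakk>
      \<Longrightarrow> fmor F X Y f \<in> Mor D (fobj F X) (fobj F Y)"
    and ident_mor: "\<And>X. X \<in> Ob C \<Longrightarrow> Ident C X \<in> Mor C X X"
    and comp_mor: "\<And>X Y Z f g. \<lbrakk>X \<in> Ob C; Y \<in> Ob C; Z \<in> Ob C; f \<in> Mor C X Y; g \<in> Mor C Y Z\<rbrakk>
      \<Longrightarrow> Comp C X Y Z g f \<in> Mor C X Z"
    and ident: "\<And>X. X \<in> Ob C \<Longrightarrow> fmor F X X (Ident C X) = Ident D (fobj F X)"
    and comp: "\<And>X Y Z f g. \<lbrakk>X \<in> Ob C; Y \<in> Ob C; Z \<in> Ob C; f \<in> Mor C X Y; g \<in> Mor C Y Z\<rbrakk>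
      \<Longrightarrow> fmor F X Z (Comp C X Y Z g f)
        = Comp D (fobj F X) (fobj F Y) (fobj F Z) (fmor F Y Z g) (fmor F X Y f)"
  shows "is_functor C D F"
proof -
  interpret D: category D by fact
  have "category C"
  proof (unfold_locales, goal_cases)
    case (3 X Y f)
    show ?case
      by (rule inj_onD[OF inj[OF 3(1,2)]])
        (simp_all add: 3 ident_mor comp_mor[of X X Y] comp[of X X Y] ident mor obj D.comp_ident)
  next
    case (4 X Y f)
    show ?case
      by (rule inj_onD[OF inj[OF 4(1,2)]])
        (simp_all add: 4 ident_mor comp_mor[of X Y Y] comp[of X Y Y] ident mor obj D.ident_comp)
  next
    case (5 W X Y Z f g h)
    show ?case
      by (rule inj_onD[OF inj[OF 5(1,4)]])
        (simp_all add: 5 comp_mor[of W X Y] comp_mor[of X Y Z] comp_mor[of W X Z] comp_mor[of W Y Z]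
          comp[of W X Y] comp[of X Y Z] comp[of W X Z] comp[of W Y Z] mor obj D.comp_assoc)
  qed (simp_all add: ident_mor comp_mor)
  then show ?thesis
    by (intro is_functor.intro is_functor_axioms.intro D) (simp_all add: obj mor ident comp)
qed

section \<open>The totalization functor\<close>

lemma mod_hom_comp:
  assumes "module R L" and f: "f \<in> mod_hom R L M" and g: "g \<in> mod_hom R M N"
  shows "(\<lambda>x\<in>carrier L. g (f x)) \<in> mod_hom R L N"
proof -
  interpret L: module R L by fact
  show ?thesis
    by (rule mod_homI) (simp_all add: mod_hom_closed[OF f] mod_hom_closed[OF g] mod_hom_add[OF f] mod_hom_add[OF g]
        mod_hom_smult[OF f] mod_hom_smult[OF g])
qed

lemma filtered_complexD:
  assumes "filtered_complex R K"
  shows "module R (cmod K n)" "cdiff K n \<in> mod_hom R (cmod K n) (cmod K (n + 1))"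
    "x \<in> carrier (cmod K n) \<Longrightarrow> cdiff K n x \<in> carrier (cmod K (n + 1))"
    "cfilt K p n \<subseteq> carrier (cmod K n)"
proof -
  show "module R (cmod K n)" and d: "cdiff K n \<in> mod_hom R (cmod K n) (cmod K (n + 1))"
    using assms by (simp_all add: filtered_complex_def is_module_def)
  show "cdiff K n x \<in> carrier (cmod K (n + 1))" if "x \<in> carrier (cmod K n)"
    using mod_hom_closed[OF d that] .
  have "carrier (cmod K n) = (\<Union>p. cfilt K p n)"
    using assms by (simp add: filtered_complex_def)
  then show "cfilt K p n \<subseteq> carrier (cmod K n)" by blast
qed

lemma filtered_morD:
  assumes "f \<in> filtered_mor R K L"
  shows "f n \<in> mod_hom R (cmod K n) (cmod L n)"
    "x \<in> carrier (cmod K n) \<Longrightarrow> f n x \<in> carrier (cmod L n)"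
    "x \<notin> carrier (cmod K n) \<Longrightarrow> f n x = undefined"
    "x \<in> carrier (cmod K n) \<Longrightarrow> f (n + 1) (cdiff K n x) = cdiff L n (f n x)"
    "x \<in> cfilt K p n \<Longrightarrow> f n x \<in> cfilt L p n"
proof -
  show f: "f n \<in> mod_hom R (cmod K n) (cmod L n)"
    using assms by (simp add: filtered_mor_def)
  show "x \<in> carrier (cmod K n) \<Longrightarrow> f n x \<in> carrier (cmod L n)"
    using mod_hom_closed[OF f] .
  show "x \<notin> carrier (cmod K n) \<Longrightarrow> f n x = undefined"
    using f by (auto simp: mod_hom_def PiE_def extensional_def)
  show "x \<in> carrier (cmod K n) \<Longrightarrow> f (n + 1) (cdiff K n x) = cdiff L n (f n x)"
    "x \<in> cfilt K p n \<Longrightarrow> f n x \<in> cfilt L p n"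
    using assms by (simp_all add: filtered_mor_def image_subset_iff)
qed

lemma filtered_id_mor:
  assumes "filtered_complex R K"
  shows "filtered_id K \<in> filtered_mor R K K"
proof -
  have "filtered_id K n \<in> mod_hom R (cmod K n) (cmod K n)" for n
  proof -
    interpret module R "cmod K n" by (rule filtered_complexD[OF assms])
    show ?thesis unfolding filtered_id_def by (rule mod_homI) simp_all
  qed
  moreover have "filtered_id K n ` cfilt K p n \<subseteq> cfilt K p n" for n p
    using filtered_complexD(4)[OF assms, of p n] by (auto simp: filtered_id_def)
  ultimately show ?thesis
    using filtered_complexD(3)[OF assms] by (simp add: filtered_mor_def filtered_id_def)
qed

lemma filtered_comp_mor:
  assumes "filtered_complex R K" "f \<in> filtered_mor R K L" "g \<in> filtered_mor R L M"
  shows "filtered_comp K g f \<in> filtered_mor R K M"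
proof -
  have "filtered_comp K g f n \<in> mod_hom R (cmod K n) (cmod M n)" for n
    unfolding filtered_comp_def
    using mod_hom_comp filtered_complexD(1)[OF assms(1)] filtered_morD(1)[OF assms(2)]
      filtered_morD(1)[OF assms(3)] by blast
  moreover have "filtered_comp K g f n ` cfilt K p n \<subseteq> cfilt M p n" for n p
    using filtered_complexD(4)[OF assms(1), of p n] filtered_morD(5)[OF assms(2)] filtered_morD(5)[OF assms(3)]
    by (auto simp: filtered_comp_def subset_iff)
  moreover have "filtered_comp K g f (n + 1) (cdiff K n x) = cdiff M n (filtered_comp K g f n x)"
    if "x \<in> carrier (cmod K n)" for n x
    using that filtered_complexD(3)[OF assms(1) that] filtered_morD(2,4)[OF assms(2) that]
      filtered_morD(4)[OF assms(3)]
    by (simp add: filtered_comp_def)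
  ultimately show ?thesis
    by (simp add: filtered_mor_def)
qed

lemma category_fC: "category (fC R)"
proof (unfold_locales, unfold fC_def cat.simps mem_Collect_eq, goal_cases)
  case (3 K L f)
  show ?case
    by (intro ext) (simp add: filtered_comp_def filtered_id_def filtered_morD(3)[OF 3(3)])
next
  case (4 K L f)
  show ?case
    by (intro ext)
      (simp add: filtered_comp_def filtered_id_def filtered_morD(2,3)[OF 4(3)])
next
  case (5 K L M N f g h)
  then show ?case
    by (intro ext) (simp add: filtered_comp_def filtered_morD(2)[OF 5(5)])
qed (blast intro: filtered_id_mor filtered_comp_mor)+

section \<open>Functoriality of totalization and of the inclusion of split complexes\<close>

lemma filtered_complex_tot:
  "twisted_complex R X \<Longrightarrow> filtered_complex R (tot_complex R X)"
  using tot_complex_split by (auto simp: split_filtered_def)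

text \<open>For identities and composites of twisted morphisms, the morphism equation follows from
  this once their total maps are known to be filtered morphisms.\<close>

lemma tot_mor_filtered_mor_iff:
  assumes "twisted_complex R X" "twisted_complex R Y" "f \<in> gmap R (tmod X) (tmod Y) 0"
  shows "tot_mor X Y f \<in> filtered_mor R (tot_complex R X) (tot_complex R Y) \<longleftrightarrow> f \<in> twisted_mor R X Y"
proof -
  interpret bigraded_pair R "tmod X" "tmod Y" 0
    using assms(1,2) by unfold_locales (simp_all add: twisted_complex_gmapD)
  show ?thesis
    using tot_map_fmap[OF assms(3)] assms(3)
    by (simp add: twisted_mor_iff[OF assms(1,2)] tot_complex_simps(2) tot_mor_eq
      filtered_mor_split_iff[OF tot_complex_simps(1,3) tot_complex_simps(1,3)])
qed

lemma twisted_mor_gmap: "f \<in> twisted_mor R X Y \<Longrightarrow> f \<in> gmap R (tmod X) (tmod Y) 0"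
  by (simp add: twisted_mor_def gmap_def)

lemma Tot_functor: "is_functor (tC R) (fC R) (Tot R)"
proof (rule faithful_functorI[OF category_fC], unfold tC_def fC_def Tot_def cat.simps cat_functor.simps mem_Collect_eq,
    goal_cases)
  case (1 X)
  then show ?case by (rule filtered_complex_tot)
next
  case (2 X Y)
  then show ?case using tot_mor_bij bij_betw_imp_inj_on by blast
next
  case (3 X Y f)
  then show ?case using tot_mor_bij bij_betwE by blast
next
  case (4 X)
  have "tot_mor X X (twisted_id X) \<in> filtered_mor R (tot_complex R X) (tot_complex R X)"
    unfolding tot_mor_twisted_id[OF twisted_complex_gmapD(1)[OF 4]]
    by (rule filtered_id_mor[OF filtered_complex_tot[OF 4]])
  then show ?case
    using tot_mor_filtered_mor_iff[OF 4 4] twisted_id_gmap twisted_complex_gmapD(1)[OF 4] by blast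
next
  case (5 X Y Z f g)
  note comp = tot_mor_comp[OF twisted_complex_gmapD(1)[OF 5(1)] twisted_complex_gmapD(1)[OF 5(2)]
      twisted_complex_gmapD(1)[OF 5(3)] twisted_mor_gmap[OF 5(4)] twisted_mor_gmap[OF 5(5)]]
  have "tot_mor X Y f \<in> filtered_mor R (tot_complex R X) (tot_complex R Y)"
    "tot_mor Y Z g \<in> filtered_mor R (tot_complex R Y) (tot_complex R Z)"
    using 5 tot_mor_bij bij_betwE by blast+
  then have "tot_mor X Z (twisted_comp X Y Z g f) \<in> filtered_mor R (tot_complex R X) (tot_complex R Z)"
    unfolding comp(2) using filtered_comp_mor filtered_complex_tot[OF 5(1)] by blast
  then show ?case
    using tot_mor_filtered_mor_iff[OF 5(1,3) comp(1)] by blast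
next
  case (6 X)
  then show ?case using tot_mor_twisted_id twisted_complex_gmapD(1) by blast
next
  case (7 X Y Z f g)
  then show ?case using tot_mor_comp(2) twisted_complex_gmapD(1) twisted_mor_gmap by blast
qed

text \<open>The inclusion is the identity on hom-sets, hence injective there, and
  \<open>faithful_functorI\<close> provides the category laws of \<open>sfC\<close> as well.\<close>

lemma sfC_inclusion_functor: "is_functor (sfC R) (fC R) sfC_inclusion"
proof -
  interpret K: category "fC R" by (rule category_fC)
  have Ob: "snd S \<in> Ob (fC R)" if "split_filtered R S" for S
    using that by (auto simp: split_filtered_def fC_def)
  show ?thesis
    by (rule faithful_functorI[OF category_fC])
      (auto simp: sfC_def sfC_inclusion_def Ob K.ident_mor intro: K.comp_mor[OF Ob Ob Ob])
qed

text \<open>\<open>sfC\<close> takes its hom-sets, identities and composition from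
  \<open>fC\<close>, so the laws carry over from \<open>Tot\<close>; only the objects require the
  splitting.\<close>

lemma Tot_split_functor: "is_functor (tC R) (sfC R) (Tot_split R)"
proof -
  interpret T: is_functor "tC R" "fC R" "Tot R" by (rule Tot_functor)
  interpret I: is_functor "sfC R" "fC R" sfC_inclusion by (rule sfC_inclusion_functor)
  show ?thesis
  proof (unfold_locales, goal_cases)
    case (1 X)
    then show ?case
      using tot_complex_split by (simp add: Tot_split_def Tot_def tC_def sfC_def)
  qed (use T.mor T.ident T.comp in \<open>simp_all add: Tot_split_def sfC_def\<close>)
qed

text \<open>Objects of \<open>sfC\<close> include their splitting, so restriction to the image is
  expressed by factoring \<open>Tot\<close> as \<open>Tot_split\<close> followed by
  \<open>sfC_inclusion\<close>, with equal images on objects.\<close>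

theorem theorem3p8:
  fixes R :: "('r, 's) ring_scheme"
  assumes "cring R"
  shows "is_functor (tC R :: (('r, 'a) twisted, _) cat) (fC R) (Tot R)
    \<and> full_subcategory_inclusion (sfC R :: (('r, 'a) split, _) cat) (fC R) sfC_inclusion
    \<and> functor_eq (tC R :: (('r, 'a) twisted, _) cat)
        (comp_functor sfC_inclusion (Tot_split R)) (Tot R)
    \<and> fobj (Tot R) ` Ob (tC R :: (('r, 'a) twisted, _) cat)
        = fobj sfC_inclusion ` Ob (sfC R :: (('r, 'a) split, _) cat)
    \<and> isomorphism_of_categories (tC R :: (('r, 'a) twisted, _) cat) (sfC R) (Tot_split R)"
proof (intro conjI)
  show "is_functor (tC R :: (('r, 'a) twisted, _) cat) (fC R) (Tot R)"
    by (rule Tot_functor)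
  \<comment> \<open>A split complex determines its splitting through \<open>tot_mod_inj\<close>, so
    forgetting the splitting identifies no two objects.\<close>
  have "A = B" if "split_filtered R (A, K)" "split_filtered R (B, K)" for A B :: "('r, 'a) bigraded" and K
    by (rule tot_mod_inj[of R]) (use that in \<open>simp_all add: split_filtered_def\<close>)
  then have "inj_on snd {S :: ('r, 'a) split. split_filtered R S}"
    by (auto simp: inj_on_def)
  then show "full_subcategory_inclusion (sfC R :: (('r, 'a) split, _) cat) (fC R) sfC_inclusion"
    unfolding full_subcategory_inclusion_def
    using sfC_inclusion_functor by (simp add: sfC_inclusion_def sfC_def bij_betw_def)
  show "functor_eq (tC R :: (('r, 'a) twisted, _) cat)
      (comp_functor sfC_inclusion (Tot_split R)) (Tot R)"
    by (simp add: functor_eq_def comp_functor_def sfC_inclusion_def Tot_split_def)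
  have "snd ` (\<lambda>X. (tmod X, tot_complex R X)) ` {X :: ('r, 'a) twisted. twisted_complex R X}
      = snd ` {S. split_filtered R S}"
    using bij_betw_imp_surj_on[OF tot_split_bij] by metis
  then show "fobj (Tot R) ` Ob (tC R :: (('r, 'a) twisted, _) cat)
      = fobj sfC_inclusion ` Ob (sfC R :: (('r, 'a) split, _) cat)"
    by (simp add: image_image Tot_def tC_def sfC_def sfC_inclusion_def)
  show "isomorphism_of_categories (tC R :: (('r, 'a) twisted, _) cat) (sfC R) (Tot_split R)"
    by (rule isomorphism_of_categoriesI[OF Tot_split_functor])
      (simp_all add: Tot_split_def Tot_def tC_def sfC_def fC_def tot_split_bij tot_mor_bij)
qed

end
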